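(* The variety of DMV-algebras is generated by the DMV-algebra $[0,1]\cap\mathbb{Q}$.
   Context: An MV-algebra is a structure $(A,\oplus,\neg,0,1)$ satisfying: $x\oplus(y\oplus z)=(x\oplus y)\oplus z$; $x\oplus y=y\oplus x$; $x\oplus 0=x$; $x\oplus 1=1$; $\neg 0=1$; $\neg 1=0$; $\neg(\neg x\oplus y)\oplus y=\neg(\neg y\oplus x)\oplus x$. One sets $x\odot y=\neg(\neg x\oplus\neg y)$. For $x\in A$ and $n\ge 0$, $n.x\in A$ is defined by $0.x=0$ and $n.x=(n-1).x\oplus x$. A DMV-algebra is a structure $A=(A,\oplus,\neg,\{\delta_n\}_{n\ge 1},0,1)$, each $\delta_n$ being a unary operation, such that $(A,\oplus,\neg,0,1)$ is an MV-algebra and for every $x\in A$ and every integer $n\ge 1$: (D1n) $n.\delta_n x=x$; (D2n) $\delta_n x\odot (n-1).\delta_n x=0$. DMV-algebras thus form a variety in the signature $\{\oplus,\neg,0,1\}\cup\{\delta_n\}_{n\ge1}$. $[0,1]\cap\mathbb{Q}$ is viewed as a DMV-algebra with $x\oplus y=\min\{1,x+y\}$, $\neg x=1-x$ and $\delta_n x=x/n$. A variety is generated by an algebra if it is the smallest variety containing that algebra. *)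

theory Defs
  imports Complex_Main
begin

record 'a mv =
  carrier :: "'a set"
  oplus :: "'a \<Rightarrow> 'a \<Rightarrow> 'a"
  neg :: "'a \<Rightarrow> 'a"
  zero :: 'a
  one :: 'a

definition odot :: "('a, 'm) mv_scheme \<Rightarrow> 'a \<Rightarrow> 'a \<Rightarrow> 'a" where
  "odot A x y = neg A (oplus A (neg A x) (neg A y))"

primrec ndot :: "('a, 'm) mv_scheme \<Rightarrow> nat \<Rightarrow> 'a \<Rightarrow> 'a" where
  "ndot A 0 x = zero A"
| "ndot A (Suc n) x = oplus A (ndot A n x) x"

locale mv_algebra =
  fixes A :: "('a, 'm) mv_scheme" (structure)
  assumes oplus_closed: "\<lbrakk>x \<in> carrier A; y \<in> carrier A\<rbrakk> \<Longrightarrow> oplus A x y \<in> carrier A"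
    and neg_closed: "x \<in> carrier A \<Longrightarrow> neg A x \<in> carrier A"
    and zero_closed: "zero A \<in> carrier A"
    and one_closed: "one A \<in> carrier A"
    and oplus_assoc: "\<lbrakk>x \<in> carrier A; y \<in> carrier A; z \<in> carrier A\<rbrakk>
      \<Longrightarrow> oplus A x (oplus A y z) = oplus A (oplus A x y) z"
    and oplus_comm: "\<lbrakk>x \<in> carrier A; y \<in> carrier A\<rbrakk> \<Longrightarrow> oplus A x y = oplus A y x"
    and oplus_zero: "x \<in> carrier A \<Longrightarrow> oplus A x (zero A) = x"
    and oplus_one: "x \<in> carrier A \<Longrightarrow> oplus A x (one A) = one A"
    and neg_zero: "neg A (zero A) = one A"
    and neg_one: "neg A (one A) = zero A"
    and lukasiewicz: "\<lbrakk>x \<in> carrier A; y \<in> carrier A\<rbrakk>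
      \<Longrightarrow> oplus A (neg A (oplus A (neg A x) y)) y = oplus A (neg A (oplus A (neg A y) x)) x"

text \<open>
  The operations of a DMV-algebra are \<open>\<delta>\<^sub>n\<close> for \<open>n \<ge> 1\<close> only. The value of the field
  \<open>delta\<close> at index \<open>0\<close> is junk, on which nothing below depends.
\<close>

record 'a dmv = "'a mv" +
  delta :: "nat \<Rightarrow> 'a \<Rightarrow> 'a"

locale dmv_algebra = mv_algebra A for A :: "('a, 'm) dmv_scheme" (structure) +
  assumes delta_closed: "\<lbrakk>1 \<le> n; x \<in> carrier A\<rbrakk> \<Longrightarrow> delta A n x \<in> carrier A"
    and D1: "\<lbrakk>1 \<le> n; x \<in> carrier A\<rbrakk> \<Longrightarrow> ndot A n (delta A n x) = x"
    and D2: "\<lbrakk>1 \<le> n; x \<in> carrier A\<rbrakk>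
      \<Longrightarrow> odot A (delta A n x) (ndot A (n - 1) (delta A n x)) = zero A"

definition rat_unit_interval :: "real dmv" where
  "rat_unit_interval =
    \<lparr> carrier = {0..1} \<inter> \<rat>,
      oplus = (\<lambda>x y. min 1 (x + y)),
      neg = (\<lambda>x. 1 - x),
      zero = 0,
      one = 1,
      delta = (\<lambda>n x. x / real n) \<rparr>"

text \<open>
  Terms in the signature \<open>{\<oplus>, \<not>, 0, 1} \<union> {\<delta>\<^sub>n | n \<ge> 1}\<close> over countably many variables.
  The constructor \<open>Delta k\<close> is the symbol \<open>\<delta>\<^sub>k\<^sub>+\<^sub>1\<close>, so that the type contains exactly the terms
  of this signature.
\<close>

datatype dmv_term =
    Var nat
  | Zero
  | One
  | Neg dmv_term
  | Oplus dmv_term dmv_term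
  | Delta nat dmv_term

primrec eval :: "('a, 'm) dmv_scheme \<Rightarrow> (nat \<Rightarrow> 'a) \<Rightarrow> dmv_term \<Rightarrow> 'a" where
  "eval A v (Var i) = v i"
| "eval A v Zero = zero A"
| "eval A v One = one A"
| "eval A v (Neg t) = neg A (eval A v t)"
| "eval A v (Oplus s t) = oplus A (eval A v s) (eval A v t)"
| "eval A v (Delta k t) = delta A (Suc k) (eval A v t)"

text \<open>Algebras of the signature, with no identities imposed.\<close>

definition dmv_structure :: "('a, 'm) dmv_scheme \<Rightarrow> bool" where
  "dmv_structure A \<longleftrightarrow>
    zero A \<in> carrier A \<and> one A \<in> carrier A \<and>
    (\<forall>x\<in>carrier A. neg A x \<in> carrier A) \<and>
    (\<forall>x\<in>carrier A. \<forall>y\<in>carrier A. oplus A x y \<in> carrier A) \<and>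
    (\<forall>n\<ge>1. \<forall>x\<in>carrier A. delta A n x \<in> carrier A)"

definition satisfies :: "('a, 'm) dmv_scheme \<Rightarrow> dmv_term \<times> dmv_term \<Rightarrow> bool" where
  "satisfies A e \<longleftrightarrow>
    (\<forall>v. (\<forall>i. v i \<in> carrier A) \<longrightarrow> eval A v (fst e) = eval A v (snd e))"

text \<open>
  A variety is the class of all algebras of the signature satisfying some set \<open>E\<close> of identities.
  This class ranges over all carrier types and so is no single HOL set: it is represented by
  \<open>E\<close>, and \<open>variety E\<close> at type \<open>'a\<close> consists of its members with carrier inside \<open>'a\<close>.
\<close>

definition variety :: "(dmv_term \<times> dmv_term) set \<Rightarrow> 'a dmv set" where
  "variety E = {A. dmv_structure A \<and> (\<forall>e\<in>E. satisfies A e)}"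

definition Odot :: "dmv_term \<Rightarrow> dmv_term \<Rightarrow> dmv_term" where
  "Odot s t = Neg (Oplus (Neg s) (Neg t))"

primrec Ndot :: "nat \<Rightarrow> dmv_term \<Rightarrow> dmv_term" where
  "Ndot 0 t = Zero"
| "Ndot (Suc n) t = Oplus (Ndot n t) t"

definition mv_identities :: "(dmv_term \<times> dmv_term) set" where
  "mv_identities =
    (let x = Var 0; y = Var 1; z = Var 2 in
     {(Oplus x (Oplus y z), Oplus (Oplus x y) z),
      (Oplus x y, Oplus y x),
      (Oplus x Zero, x),
      (Oplus x One, One),
      (Neg Zero, One),
      (Neg One, Zero),
      (Oplus (Neg (Oplus (Neg x) y)) y, Oplus (Neg (Oplus (Neg y) x)) x)})"

definition dmv_identities :: "(dmv_term \<times> dmv_term) set" where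
  "dmv_identities = mv_identities
    \<union> {(Ndot (Suc k) (Delta k (Var 0)), Var 0) | k. True}
    \<union> {(Odot (Delta k (Var 0)) (Ndot k (Delta k (Var 0))), Zero) | k. True}"

end

theory Submission
  imports Defs "HOL-Library.Multiset"
begin

text \<open>
  Soundness (the DMV-algebras form the variety given by their defining identities, and
  \<open>[0,1] \<inter> \<rat>\<close> belongs to it) is a routine verification. The content is completeness: if two
  terms \<open>s\<close>, \<open>t\<close> take different values in some DMV-algebra \<open>A\<close>, they already take different values
  in \<open>[0,1] \<inter> \<rat>\<close> (\<open>rational_separation\<close>). Only finitely many elements of \<open>A\<close> matter for this, the
  values of the subterms of \<open>s\<close> and \<open>t\<close>. They are moved into \<open>[0,1] \<inter> \<rat>\<close> in three steps.

  First, a prime ideal separating the two values (\<open>prime_ideal_avoiding\<close>) gives a totally ordered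
  quotient of the MV-reduct in which they still differ. The operations \<open>\<delta>\<^sub>n\<close> are seen in the quotient
  only through their defining conditions: \<open>n.\<delta>\<^sub>n x = x\<close> and \<open>\<delta>\<^sub>n x \<odot> (n-1).\<delta>\<^sub>n x = 0\<close> are preserved
  by every MV-homomorphism, and they say that \<open>x\<close> is a sum of \<open>n\<close> copies of \<open>\<delta>\<^sub>n x\<close> that never overflows \<open>1\<close>.

  Second, an MV-chain behaves like the unit interval \<open>[0,1]\<close> of a totally ordered abelian group,
  elements of that group being written as an integer part plus a fractional part. For the present
  purpose it is enough to compare finite formal sums of chain elements. A sum is computed by
  adding its summands one after the other to a pair (integer part, fractional part), with a carry
  on overflow. Such additions commute (\<open>step_commute\<close>) and are strictly monotone for the lexicographic
  order (\<open>step_mono\<close>), so formal sums carry a translation invariant total preorder.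

  Third, the rational numbers suffice to witness finitely many linear relations. Given finitely many
  comparisons between formal sums, Fourier-Motzkin elimination produces rational weights for the
  chain elements that respect all of them (\<open>rational_weights\<close>): an obstruction would be a sum of true
  comparisons reading \<open>M < M\<close>. Normalising the weight of \<open>1\<close> yields an injective map of any finite
  part of an MV-chain into \<open>[0,1] \<inter> \<rat>\<close> that preserves all operations inside that part and all
  non-overflowing multiples up to a given bound (\<open>rational_embedding\<close>). Evaluating \<open>s\<close> and \<open>t\<close> along
  this map separates them.
\<close>

section \<open>Order and arithmetic of MV-algebras\<close>

context mv_algebra
begin

abbreviation plus (infixl "\<oplus>" 65) where "x \<oplus> y \<equiv> oplus A x y"
abbreviation times (infixl "\<odot>" 70) where "x \<odot> y \<equiv> odot A x y"
abbreviation neg_A ("\<sim> _" [81] 80) where "\<sim> x \<equiv> neg A x"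
abbreviation C where "C \<equiv> carrier A"

text \<open>
  Truncated subtraction and the natural order. In \<open>[0,1]\<close> they are \<open>max 0 (x - y)\<close> and \<open>\<le>\<close>.
\<close>

definition diff (infixl "\<ominus>" 65) where "x \<ominus> y = \<sim> (\<sim> x \<oplus> y)"
definition le (infix "\<sqsubseteq>" 50) where "x \<sqsubseteq> y \<longleftrightarrow> \<sim> x \<oplus> y = one A"

declare oplus_closed [simp] neg_closed [simp] zero_closed [simp] one_closed [simp]
  oplus_zero [simp] oplus_one [simp] neg_zero [simp] neg_one [simp]

lemma odot_closed [simp]: "x \<in> C \<Longrightarrow> y \<in> C \<Longrightarrow> x \<odot> y \<in> C"
  by (simp add: odot_def)

lemma diff_closed [simp]: "x \<in> C \<Longrightarrow> y \<in> C \<Longrightarrow> x \<ominus> y \<in> C"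
  by (simp add: diff_def)

lemma ndot_closed [simp]: "x \<in> C \<Longrightarrow> ndot A n x \<in> C"
  by (induction n) auto

lemma zero_oplus [simp]: "x \<in> C \<Longrightarrow> zero A \<oplus> x = x"
  by (simp add: oplus_comm[of "zero A"])

lemma one_oplus [simp]: "x \<in> C \<Longrightarrow> one A \<oplus> x = one A"
  by (simp add: oplus_comm[of "one A"])

lemma neg_neg [simp]: "x \<in> C \<Longrightarrow> \<sim> (\<sim> x) = x"
  using lukasiewicz[of x "zero A"] by simp

lemma neg_oplus_self [simp]: "x \<in> C \<Longrightarrow> \<sim> x \<oplus> x = one A"
  using lukasiewicz[of x "one A"] by simp

lemma oplus_neg_self [simp]: "x \<in> C \<Longrightarrow> x \<oplus> \<sim> x = one A"
  by (simp add: oplus_comm[of x])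

lemma oplus_left_comm: "x \<in> C \<Longrightarrow> y \<in> C \<Longrightarrow> z \<in> C \<Longrightarrow> x \<oplus> (y \<oplus> z) = y \<oplus> (x \<oplus> z)"
  by (metis oplus_assoc oplus_comm)

lemmas oplus_ac = oplus_assoc[symmetric] oplus_comm oplus_left_comm

lemma le_refl [simp]: "x \<in> C \<Longrightarrow> x \<sqsubseteq> x"
  by (simp add: le_def)

lemma le_antisym: "x \<in> C \<Longrightarrow> y \<in> C \<Longrightarrow> x \<sqsubseteq> y \<Longrightarrow> y \<sqsubseteq> x \<Longrightarrow> x = y"
  using lukasiewicz[of x y] by (simp add: le_def)

lemma le_oplus [simp]: "x \<in> C \<Longrightarrow> y \<in> C \<Longrightarrow> x \<sqsubseteq> x \<oplus> y"
  by (simp add: le_def oplus_assoc)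

lemma le_oplus2 [simp]: "x \<in> C \<Longrightarrow> y \<in> C \<Longrightarrow> x \<sqsubseteq> y \<oplus> x"
  by (metis le_oplus oplus_comm)

lemma diff_oplus: "x \<in> C \<Longrightarrow> y \<in> C \<Longrightarrow> x \<sqsubseteq> y \<Longrightarrow> (y \<ominus> x) \<oplus> x = y"
  using lukasiewicz[of x y] by (simp add: le_def diff_def)

lemma le_trans: "x \<in> C \<Longrightarrow> y \<in> C \<Longrightarrow> z \<in> C \<Longrightarrow> x \<sqsubseteq> y \<Longrightarrow> y \<sqsubseteq> z \<Longrightarrow> x \<sqsubseteq> z"
  by (metis diff_oplus diff_closed le_oplus2 oplus_assoc oplus_closed)

lemma zero_le [simp]: "x \<in> C \<Longrightarrow> zero A \<sqsubseteq> x"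
  by (simp add: le_def)

lemma le_one [simp]: "x \<in> C \<Longrightarrow> x \<sqsubseteq> one A"
  by (simp add: le_def)

lemma le_zero: "x \<in> C \<Longrightarrow> x \<sqsubseteq> zero A \<longleftrightarrow> x = zero A"
  by (metis le_antisym zero_le zero_closed)

lemma one_le: "x \<in> C \<Longrightarrow> one A \<sqsubseteq> x \<longleftrightarrow> x = one A"
  by (simp add: le_def)

lemma oplus_mono:
  assumes "x \<in> C" "y \<in> C" "x' \<in> C" "y' \<in> C" "x \<sqsubseteq> x'" "y \<sqsubseteq> y'"
  shows "x \<oplus> y \<sqsubseteq> x' \<oplus> y'"
proof -
  have "x' \<oplus> y' = ((x' \<ominus> x) \<oplus> x) \<oplus> ((y' \<ominus> y) \<oplus> y)"
    using assms by (simp add: diff_oplus)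
  also have "\<dots> = (x \<oplus> y) \<oplus> ((x' \<ominus> x) \<oplus> (y' \<ominus> y))"
    using assms by (simp add: oplus_ac)
  finally show ?thesis
    using assms by simp
qed

lemma neg_le: "x \<in> C \<Longrightarrow> y \<in> C \<Longrightarrow> \<sim> x \<sqsubseteq> \<sim> y \<longleftrightarrow> y \<sqsubseteq> x"
  by (simp add: le_def oplus_comm)

text \<open>
  Residuation: truncated subtraction is left adjoint to \<open>\<oplus>\<close>. It is associativity of \<open>\<oplus>\<close> read through
  the definitions, and it replaces most lattice arguments below.
\<close>

lemma diff_le_iff: "x \<in> C \<Longrightarrow> y \<in> C \<Longrightarrow> z \<in> C \<Longrightarrow> x \<ominus> y \<sqsubseteq> z \<longleftrightarrow> x \<sqsubseteq> y \<oplus> z"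
  by (simp add: le_def diff_def oplus_assoc)

lemma diff_eq_zero: "x \<in> C \<Longrightarrow> y \<in> C \<Longrightarrow> x \<ominus> y = zero A \<longleftrightarrow> x \<sqsubseteq> y"
  by (metis diff_le_iff le_zero oplus_zero zero_closed diff_closed)

lemma diff_le: "x \<in> C \<Longrightarrow> y \<in> C \<Longrightarrow> x \<ominus> y \<sqsubseteq> x"
  by (simp add: diff_le_iff)

lemma le_diff_oplus: "x \<in> C \<Longrightarrow> y \<in> C \<Longrightarrow> x \<sqsubseteq> y \<oplus> (x \<ominus> y)"
  by (metis diff_le_iff diff_closed le_refl)

lemma diff_mono: 
  assumes "x \<in> C" "x' \<in> C" "y \<in> C" "x \<sqsubseteq> x'"
  shows "x \<ominus> y \<sqsubseteq> x' \<ominus> y"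
  using assms le_diff_oplus[of x' y] le_trans[of x x' "y \<oplus> (x' \<ominus> y)"] by (simp add: diff_le_iff)

text \<open>
  The hypothesis says that the sum does not overflow, the case in which \<open>\<oplus>\<close> is cancellative.
\<close>

lemma oplus_diff:
  assumes "x \<in> C" "y \<in> C" "x \<sqsubseteq> \<sim> y"
  shows "(x \<oplus> y) \<ominus> y = x"
proof -
  have "\<sim> ((x \<oplus> y) \<ominus> y) = \<sim> x"
    using assms lukasiewicz[of "\<sim> x" y] by (simp add: diff_def le_def oplus_comm)
  then show ?thesis
    using assms by (metis neg_neg diff_closed oplus_closed)
qed

lemma diff_diff:
  assumes "x \<in> C" "y \<in> C" "x \<sqsubseteq> y"
  shows "y \<ominus> (y \<ominus> x) = x"
proof -
  have "\<sim> (y \<ominus> (y \<ominus> x)) = \<sim> x"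
    using assms lukasiewicz[of "\<sim> x" "\<sim> y"] by (simp add: diff_def le_def oplus_comm)
  then show ?thesis
    using assms by (metis neg_neg diff_closed)
qed

lemma odot_eq_diff: "x \<in> C \<Longrightarrow> y \<in> C \<Longrightarrow> x \<odot> y = y \<ominus> \<sim> x"
  by (simp add: odot_def diff_def oplus_comm)

lemma odot_comm: "x \<in> C \<Longrightarrow> y \<in> C \<Longrightarrow> x \<odot> y = y \<odot> x"
  by (simp add: odot_def oplus_comm)

lemma odot_assoc: "x \<in> C \<Longrightarrow> y \<in> C \<Longrightarrow> z \<in> C \<Longrightarrow> x \<odot> y \<odot> z = x \<odot> (y \<odot> z)"
  by (simp add: odot_def oplus_assoc)

lemma odot_eq_zero: "x \<in> C \<Longrightarrow> y \<in> C \<Longrightarrow> x \<odot> y = zero A \<longleftrightarrow> x \<sqsubseteq> \<sim> y"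
  by (metis diff_def diff_eq_zero neg_closed neg_neg odot_def)

lemma oplus_eq_one: "x \<in> C \<Longrightarrow> y \<in> C \<Longrightarrow> x \<oplus> y = one A \<longleftrightarrow> \<sim> x \<sqsubseteq> y"
  by (simp add: le_def)

lemma odot_le: "x \<in> C \<Longrightarrow> y \<in> C \<Longrightarrow> x \<odot> y \<sqsubseteq> y"
  by (simp add: odot_eq_diff diff_le)

text \<open>
  The Lukasiewicz axiom makes \<open>s = (x \<ominus> y) \<oplus> y\<close> symmetric in \<open>x\<close> and \<open>y\<close>: it is their supremum.
  If \<open>z\<close> lies below both differences, adding \<open>z\<close> to \<open>x\<close> or to \<open>y\<close> neither overflows nor exceeds \<open>s\<close>, so
  \<open>x\<close> and \<open>y\<close> are both at most \<open>s \<ominus> z\<close>. Hence \<open>s \<ominus> z = s\<close>, and this forces \<open>z = 0\<close>.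
\<close>

lemma prelinearity:
  assumes C: "x \<in> C" "y \<in> C" "z \<in> C" and z: "z \<sqsubseteq> x \<ominus> y" "z \<sqsubseteq> y \<ominus> x"
  shows "z = zero A"
proof -
  define s where "s = (x \<ominus> y) \<oplus> y"
  have s: "s = (y \<ominus> x) \<oplus> x"
    using C lukasiewicz[of x y] by (simp add: s_def diff_def)
  have [simp]: "s \<in> C"
    using C by (simp add: s_def)
  have below: "u \<sqsubseteq> s \<ominus> z"
    if [simp]: "u \<in> C" "w \<in> C" and zu: "z \<sqsubseteq> w \<ominus> u" and su: "s = (w \<ominus> u) \<oplus> u" for u w
  proof -
    have "u \<sqsubseteq> \<sim> z"
    proof -
      have "\<sim> (w \<ominus> u) \<sqsubseteq> \<sim> z"
        using C zu by (simp add: neg_le)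
      moreover have "u \<sqsubseteq> \<sim> (w \<ominus> u)"
        by (simp add: diff_def)
      ultimately show ?thesis
        using C le_trans by (meson diff_closed neg_closed that(1,2))
    qed
    then have "u = (u \<oplus> z) \<ominus> z"
      using C by (simp add: oplus_diff)
    moreover have "u \<oplus> z \<sqsubseteq> s"
      using C zu by (simp add: su oplus_comm[of u] oplus_mono)
    ultimately show ?thesis
      using C diff_mono[of "u \<oplus> z" s z] by simp
  qed
  have "s \<sqsubseteq> s \<ominus> z"
  proof -
    have "y \<sqsubseteq> s \<ominus> z" "x \<sqsubseteq> s \<ominus> z"
      using C z below s s_def by blast+
    then have "s \<sqsubseteq> ((s \<ominus> z) \<ominus> y) \<oplus> y"
      using C unfolding s_def by (intro oplus_mono diff_mono) (auto simp flip: s_def)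
    then show ?thesis
      using \<open>y \<sqsubseteq> s \<ominus> z\<close> C by (simp add: diff_oplus)
  qed
  then have "s \<ominus> z = s"
    using C by (meson diff_closed diff_le le_antisym \<open>s \<in> C\<close>)
  moreover have "z \<sqsubseteq> s"
    using C z by (metis diff_closed le_oplus le_trans s_def \<open>s \<in> C\<close>)
  ultimately have "z = s \<ominus> s"
    using C diff_diff[of z s] by simp
  then show ?thesis
    using C by (simp add: diff_eq_zero)
qed

text \<open>
  Disjointness passes to multiples because \<open>z \<sqsubseteq> n.w \<oplus> w\<close> gives \<open>z \<ominus> n.w \<sqsubseteq> w\<close>, and the left-hand side is
  also below \<open>u\<close>.
\<close>

lemma disjoint_ndot:
  assumes C: "u \<in> C" "w \<in> C" and disj: "\<And>z. z \<in> C \<Longrightarrow> z \<sqsubseteq> u \<Longrightarrow> z \<sqsubseteq> w \<Longrightarrow> z = zero A"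
    and z: "z \<in> C" "z \<sqsubseteq> u" "z \<sqsubseteq> ndot A n w"
  shows "z = zero A"
  using z
proof (induction n arbitrary: z)
  case 0
  then show ?case by (simp add: le_zero)
next
  case (Suc n)
  have "z \<ominus> ndot A n w \<sqsubseteq> w"
    using Suc.prems C by (simp add: diff_le_iff)
  moreover have "z \<ominus> ndot A n w \<sqsubseteq> u"
    using Suc.prems C by (meson diff_closed diff_le le_trans ndot_closed)
  ultimately have "z \<sqsubseteq> ndot A n w"
    using disj[of "z \<ominus> ndot A n w"] Suc.prems C by (simp add: diff_eq_zero)
  then show ?case
    using Suc by blast
qed

lemma disjoint_ndot_ndot:
  assumes C: "u \<in> C" "w \<in> C" and disj: "\<And>z. z \<in> C \<Longrightarrow> z \<sqsubseteq> u \<Longrightarrow> z \<sqsubseteq> w \<Longrightarrow> z = zero A"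
    and z: "z \<in> C" "z \<sqsubseteq> ndot A m u" "z \<sqsubseteq> ndot A n w"
  shows "z = zero A"
proof (rule disjoint_ndot[where u = "ndot A n w" and w = u and n = m])
  show "y = zero A" if "y \<in> C" "y \<sqsubseteq> ndot A n w" "y \<sqsubseteq> u" for y
    using disjoint_ndot[OF C disj] that by blast
qed (use C z in auto)

lemma ndot_add: "x \<in> C \<Longrightarrow> ndot A (m + n) x = ndot A m x \<oplus> ndot A n x"
  by (induction n) (auto simp: oplus_assoc)

lemma ndot_mono: "x \<in> C \<Longrightarrow> m \<le> n \<Longrightarrow> ndot A m x \<sqsubseteq> ndot A n x"
  by (metis le_add_diff_inverse le_oplus ndot_add ndot_closed)

end

section \<open>Prime ideals\<close>

context mv_algebra
begin

definition ideal where
  "ideal J \<longleftrightarrow> J \<subseteq> C \<and> zero A \<in> J \<and> (\<forall>x\<in>J. \<forall>y\<in>J. x \<oplus> y \<in> J) \<and> (\<forall>x\<in>J. \<forall>y\<in>C. y \<sqsubseteq> x \<longrightarrow> y \<in> J)"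

lemma ideal_span:
  assumes J: "ideal J" and u: "u \<in> C"
  shows "ideal {z \<in> C. \<exists>p\<in>J. \<exists>n. z \<sqsubseteq> p \<oplus> ndot A n u}" (is "ideal ?K")
  unfolding ideal_def
proof (intro conjI ballI impI)
  have JC: "p \<in> C" if "p \<in> J" for p
    using J that by (auto simp: ideal_def)
  show "?K \<subseteq> C" by auto
  show "zero A \<in> ?K"
    using J u by (auto simp: ideal_def intro!: bexI[of _ "zero A"])
  fix x assume x: "x \<in> ?K"
  then obtain p m where p: "p \<in> J" "x \<sqsubseteq> p \<oplus> ndot A m u" "x \<in> C" by blast
  { fix y assume "y \<in> ?K"
    then obtain q n where q: "q \<in> J" "y \<sqsubseteq> q \<oplus> ndot A n u" "y \<in> C" by blast
    have "x \<oplus> y \<sqsubseteq> (p \<oplus> ndot A m u) \<oplus> (q \<oplus> ndot A n u)"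
      using p q u JC by (intro oplus_mono) auto
    also have "\<dots> = (p \<oplus> q) \<oplus> ndot A (m + n) u"
      using p q u JC by (simp add: ndot_add oplus_ac)
    finally show "x \<oplus> y \<in> ?K"
      using J p q by (auto simp: ideal_def) }
  { fix y assume "y \<in> C" "y \<sqsubseteq> x"
    then show "y \<in> ?K"
      using p u JC le_trans[of y x "p \<oplus> ndot A m u"] by auto }
qed

text \<open>
  Primeness is stated as the property that makes the quotient totally ordered.
\<close>

definition prime_ideal where
  "prime_ideal P \<longleftrightarrow> ideal P \<and> (\<forall>x\<in>C. \<forall>y\<in>C. x \<ominus> y \<in> P \<or> y \<ominus> x \<in> P)"

text \<open>
  An ideal maximal among those avoiding \<open>d\<close> is prime. Otherwise adding either \<open>x \<ominus> y\<close> or \<open>y \<ominus> x\<close> to it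
  captures \<open>d\<close>, so that \<open>d\<close> minus an element of the ideal lies below multiples of both differences.
  These multiples are disjoint, so \<open>d\<close> itself is in the ideal.
\<close>

lemma prime_ideal_avoiding:
  assumes d: "d \<in> C" "d \<noteq> zero A"
  shows "\<exists>P. prime_ideal P \<and> d \<notin> P"
proof -
  let ?I = "{J. ideal J \<and> d \<notin> J}"
  have "\<exists>P\<in>?I. \<forall>J\<in>?I. P \<subseteq> J \<longrightarrow> J = P"
  proof (rule subset_Zorn_nonempty)
    have "ideal {zero A}"
      by (auto simp: ideal_def le_zero)
    then show "?I \<noteq> {}"
      using d by blast
    fix K assume K: "K \<noteq> {}" "subset.chain ?I K"
    have sumK: "x \<oplus> y \<in> \<Union>K" if xy: "x \<in> \<Union>K" "y \<in> \<Union>K" for x y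
    proof -
      obtain I J where IJ: "I \<in> K" "J \<in> K" "x \<in> I" "y \<in> J"
        using xy by blast
      then have "I \<subseteq> J \<or> J \<subseteq> I" and sum: "\<And>L x y. L \<in> {I, J} \<Longrightarrow> x \<in> L \<Longrightarrow> y \<in> L \<Longrightarrow> x \<oplus> y \<in> L"
        using K by (auto simp: subset.chain_def ideal_def)
      then have "x \<oplus> y \<in> I \<or> x \<oplus> y \<in> J"
        using IJ sum[of I x y] sum[of J x y] by auto
      then show ?thesis
        using IJ by blast
    qed
    have *: "J \<subseteq> C" "zero A \<in> J" "d \<notin> J" "\<forall>x\<in>J. \<forall>y\<in>C. y \<sqsubseteq> x \<longrightarrow> y \<in> J" if "J \<in> K" for J
      using K that by (auto simp: subset.chain_def ideal_def)
    have downK: "\<forall>x\<in>\<Union>K. \<forall>y\<in>C. y \<sqsubseteq> x \<longrightarrow> y \<in> \<Union>K"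
      using *(4) by (meson Union_iff)
    have "\<Union>K \<subseteq> C" "d \<notin> \<Union>K" "zero A \<in> \<Union>K"
      using *(1-3) K(1) by auto
    then show "\<Union>K \<in> ?I"
      unfolding ideal_def mem_Collect_eq by (intro conjI ballI sumK downK) assumption+
  qed
  then obtain P where P: "ideal P" "d \<notin> P" and max: "\<And>J. ideal J \<Longrightarrow> d \<notin> J \<Longrightarrow> P \<subseteq> J \<Longrightarrow> J = P"
    by blast
  have PC: "p \<in> C" if "p \<in> P" for p
    using P that by (auto simp: ideal_def)
  have span: "\<exists>p\<in>P. \<exists>n. d \<sqsubseteq> p \<oplus> ndot A n u" if u: "u \<in> C" "u \<notin> P" for u
  proof (rule ccontr)
    let ?K = "{z \<in> C. \<exists>p\<in>P. \<exists>n. z \<sqsubseteq> p \<oplus> ndot A n u}"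
    assume "\<not> ?thesis"
    then have "d \<notin> ?K" by blast
    moreover have "P \<subseteq> ?K"
    proof
      fix p assume p: "p \<in> P"
      then have "p \<sqsubseteq> p \<oplus> ndot A 0 u"
        using PC by simp
      then show "p \<in> ?K"
        using p PC by blast
    qed
    ultimately have "?K = P"
      using max ideal_span[OF P(1) u(1)] by blast
    moreover have "u \<in> ?K"
      using u P by (auto simp: ideal_def intro!: bexI[of _ "zero A"] exI[of _ 1])
    ultimately show False
      using u by blast
  qed
  have "x \<ominus> y \<in> P \<or> y \<ominus> x \<in> P" if x: "x \<in> C" and y: "y \<in> C" for x y
  proof (rule ccontr)
    assume neither: "\<not> ?thesis"
    obtain p m where p: "p \<in> P" "d \<sqsubseteq> p \<oplus> ndot A m (x \<ominus> y)"
      using span[of "x \<ominus> y"] x y neither by auto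
    obtain q n where q: "q \<in> P" "d \<sqsubseteq> q \<oplus> ndot A n (y \<ominus> x)"
      using span[of "y \<ominus> x"] x y neither by auto
    \<comment> \<open>Adding both ideal elements gives a common bound, to which disjointness of the multiples applies.\<close>
    let ?r = "p \<oplus> q"
    have "d \<sqsubseteq> ?r \<oplus> ndot A m (x \<ominus> y)"
      using p q d x y PC oplus_mono[of p "ndot A m (x \<ominus> y)" ?r "ndot A m (x \<ominus> y)"]
      by (auto intro: le_trans[of _ "p \<oplus> ndot A m (x \<ominus> y)"])
    moreover have "d \<sqsubseteq> ?r \<oplus> ndot A n (y \<ominus> x)"
      using p q d x y PC oplus_mono[of q "ndot A n (y \<ominus> x)" ?r "ndot A n (y \<ominus> x)"]
      by (auto intro: le_trans[of _ "q \<oplus> ndot A n (y \<ominus> x)"])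
    ultimately have "d \<ominus> ?r \<sqsubseteq> ndot A m (x \<ominus> y)" "d \<ominus> ?r \<sqsubseteq> ndot A n (y \<ominus> x)"
      using p q d x y PC by (simp_all add: diff_le_iff)
    then have "d \<ominus> ?r = zero A"
      using disjoint_ndot_ndot[of "x \<ominus> y" "y \<ominus> x" "d \<ominus> ?r" m n] prelinearity[of x y] x y d p q PC
      by simp
    then have "d \<sqsubseteq> ?r"
      using d p q PC by (simp add: diff_eq_zero)
    then show False
      using P p q d unfolding ideal_def by blast
  qed
  then show ?thesis
    using P unfolding prime_ideal_def by blast
qed

end

section \<open>Totally ordered quotients\<close>

context mv_algebra
begin

definition cong where "cong P x y \<longleftrightarrow> x \<ominus> y \<in> P \<and> y \<ominus> x \<in> P"

text \<open>
  The quotient is built on chosen representatives instead of equivalence classes. It then has the same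
  element type as the algebra, and \<open>rep P\<close> is the quotient homomorphism.
\<close>

definition rep where "rep P x = (SOME y. y \<in> C \<and> cong P x y)"

definition quotient :: "'a set \<Rightarrow> 'a mv" where
  "quotient P =
    \<lparr> carrier = rep P ` C, oplus = (\<lambda>x y. rep P (x \<oplus> y)), neg = (\<lambda>x. rep P (\<sim> x)),
      zero = rep P (zero A), one = rep P (one A) \<rparr>"

lemma ideal_downward: "ideal P \<Longrightarrow> x \<in> P \<Longrightarrow> y \<in> C \<Longrightarrow> y \<sqsubseteq> x \<Longrightarrow> y \<in> P"
  by (auto simp: ideal_def)

lemma ideal_oplus: "ideal P \<Longrightarrow> x \<in> P \<Longrightarrow> y \<in> P \<Longrightarrow> x \<oplus> y \<in> P"
  by (auto simp: ideal_def)

lemma ideal_zero: "ideal P \<Longrightarrow> zero A \<in> P"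
  by (auto simp: ideal_def)

lemma diff_triangle:
  assumes "x \<in> C" "y \<in> C" "z \<in> C"
  shows "x \<ominus> z \<sqsubseteq> (x \<ominus> y) \<oplus> (y \<ominus> z)"
proof -
  have "x \<sqsubseteq> y \<oplus> (x \<ominus> y)"
    using assms by (simp add: le_diff_oplus)
  also have "y \<oplus> (x \<ominus> y) \<sqsubseteq> (z \<oplus> (y \<ominus> z)) \<oplus> (x \<ominus> y)"
    using assms by (intro oplus_mono) (auto simp: le_diff_oplus)
  finally (le_trans[rotated 3]) have "x \<sqsubseteq> (z \<oplus> (y \<ominus> z)) \<oplus> (x \<ominus> y)"
    using assms by simp
  then show ?thesis
    using assms by (simp add: diff_le_iff oplus_ac)
qed

lemma diff_oplus_oplus:
  assumes "x \<in> C" "x' \<in> C" "y \<in> C"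
  shows "(x \<oplus> y) \<ominus> (x' \<oplus> y) \<sqsubseteq> x \<ominus> x'"
proof -
  have "x \<oplus> y \<sqsubseteq> (x' \<oplus> (x \<ominus> x')) \<oplus> y"
    using assms by (intro oplus_mono) (auto simp: le_diff_oplus)
  then show ?thesis
    using assms by (simp add: diff_le_iff oplus_ac)
qed

lemma cong_refl: "ideal P \<Longrightarrow> x \<in> C \<Longrightarrow> cong P x x"
  by (metis cong_def diff_eq_zero ideal_zero le_refl)

lemma cong_sym: "cong P x y \<Longrightarrow> cong P y x"
  by (auto simp: cong_def)

lemma cong_trans:
  assumes "ideal P" "x \<in> C" "y \<in> C" "z \<in> C" "cong P x y" "cong P y z"
  shows "cong P x z"
  using assms diff_triangle[of x y z] diff_triangle[of z y x]
  unfolding cong_def by (meson diff_closed ideal_downward ideal_oplus)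

lemma cong_oplus:
  assumes "ideal P" "x \<in> C" "x' \<in> C" "y \<in> C" "cong P x x'"
  shows "cong P (x \<oplus> y) (x' \<oplus> y)"
  using assms diff_oplus_oplus[of x x' y] diff_oplus_oplus[of x' x y]
  unfolding cong_def by (meson diff_closed oplus_closed ideal_downward)

lemma cong_neg:
  assumes "x \<in> C" "y \<in> C" "cong P x y"
  shows "cong P (\<sim> x) (\<sim> y)"
  using assms by (simp add: cong_def diff_def oplus_comm)

context
  fixes P
  assumes P: "ideal P"
begin

lemma rep_cong: 
  assumes "x \<in> C"
  shows "rep P x \<in> C \<and> cong P x (rep P x)"
  unfolding rep_def by (rule someI[of _ x]) (use assms cong_refl[OF P] in blast)

lemma rep_closed [simp]: "x \<in> C \<Longrightarrow> rep P x \<in> C"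
  using rep_cong by blast

lemma rep_eq_iff: "x \<in> C \<Longrightarrow> y \<in> C \<Longrightarrow> rep P x = rep P y \<longleftrightarrow> cong P x y"
proof
  assume C: "x \<in> C" "y \<in> C" and "cong P x y"
  then have "(\<lambda>z. z \<in> C \<and> cong P x z) = (\<lambda>z. z \<in> C \<and> cong P y z)"
    using cong_trans[OF P] cong_sym by blast
  then show "rep P x = rep P y"
    by (simp add: rep_def)
next
  assume "x \<in> C" "y \<in> C" "rep P x = rep P y"
  then show "cong P x y"
    by (metis P cong_sym cong_trans rep_cong)
qed

lemma rep_rep [simp]: "x \<in> C \<Longrightarrow> rep P (rep P x) = rep P x"
  using rep_cong[of x] cong_sym by (simp add: rep_eq_iff)

lemma rep_oplus1 [simp]: "x \<in> C \<Longrightarrow> y \<in> C \<Longrightarrow> rep P (rep P x \<oplus> y) = rep P (x \<oplus> y)"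
  using rep_cong[of x] cong_sym cong_oplus[OF P] by (simp add: rep_eq_iff)

lemma rep_oplus2 [simp]: "x \<in> C \<Longrightarrow> y \<in> C \<Longrightarrow> rep P (x \<oplus> rep P y) = rep P (x \<oplus> y)"
  by (metis oplus_comm rep_closed rep_oplus1)

lemma rep_neg [simp]: "x \<in> C \<Longrightarrow> rep P (\<sim> (rep P x)) = rep P (\<sim> x)"
  using rep_cong[of x] cong_sym cong_neg by (simp add: rep_eq_iff)

lemma quotient_mv_algebra: "mv_algebra (quotient P)"
proof
  show "oplus (quotient P) x y \<in> carrier (quotient P)"
    if "x \<in> carrier (quotient P)" "y \<in> carrier (quotient P)" for x y
    using that by (auto simp: quotient_def)
  show "oplus (quotient P) x (oplus (quotient P) y z) = oplus (quotient P) (oplus (quotient P) x y) z"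
    if "x \<in> carrier (quotient P)" "y \<in> carrier (quotient P)" "z \<in> carrier (quotient P)" for x y z
    using that by (auto simp: quotient_def simp flip: oplus_assoc)
  show "oplus (quotient P) x y = oplus (quotient P) y x"
    if "x \<in> carrier (quotient P)" "y \<in> carrier (quotient P)" for x y
    using that by (auto simp: quotient_def oplus_comm)
  show "oplus (quotient P) (neg (quotient P) (oplus (quotient P) (neg (quotient P) x) y)) y
      = oplus (quotient P) (neg (quotient P) (oplus (quotient P) (neg (quotient P) y) x)) x"
    if "x \<in> carrier (quotient P)" "y \<in> carrier (quotient P)" for x y
    using that lukasiewicz by (auto simp: quotient_def)
qed (auto simp: quotient_def)

lemma rep_hom:
  "zero (quotient P) = rep P (zero A)" "one (quotient P) = rep P (one A)"
  "x \<in> C \<Longrightarrow> neg (quotient P) (rep P x) = rep P (\<sim> x)"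
  "x \<in> C \<Longrightarrow> y \<in> C \<Longrightarrow> oplus (quotient P) (rep P x) (rep P y) = rep P (x \<oplus> y)"
  by (simp_all add: quotient_def)

lemma rep_ndot: "x \<in> C \<Longrightarrow> ndot (quotient P) n (rep P x) = rep P (ndot A n x)"
  by (induction n) (simp_all add: rep_hom)

lemma rep_odot: "x \<in> C \<Longrightarrow> y \<in> C \<Longrightarrow> odot (quotient P) (rep P x) (rep P y) = rep P (x \<odot> y)"
  by (simp add: odot_def rep_hom)

end

end

locale mv_chain = mv_algebra A for A :: "('a, 'm) mv_scheme" (structure) +
  assumes total: "x \<in> carrier A \<Longrightarrow> y \<in> carrier A \<Longrightarrow> x \<sqsubseteq> y \<or> y \<sqsubseteq> x"

lemma (in mv_algebra) quotient_mv_chain: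
  assumes "prime_ideal P"
  shows "mv_chain (quotient P)"
proof -
  have P: "ideal P"
    using assms by (simp add: prime_ideal_def)
  interpret Q: mv_algebra "quotient P"
    by (rule quotient_mv_algebra[OF P])
  have le: "Q.le (rep P x) (rep P y)" if "x \<in> C" "y \<in> C" "x \<ominus> y \<in> P" for x y
  proof -
    have "cong P (\<sim> x \<oplus> y) (one A)"
      using that ideal_zero[OF P] by (simp add: cong_def diff_def)
    then show ?thesis
      unfolding Q.le_def using that P by (simp add: quotient_def rep_eq_iff)
  qed
  show ?thesis
  proof
    fix x y assume "x \<in> carrier (quotient P)" "y \<in> carrier (quotient P)"
    then obtain a b where "a \<in> C" "b \<in> C" "x = rep P a" "y = rep P b"
      by (auto simp: quotient_def)
    then show "Q.le x y \<or> Q.le y x"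
      using assms le[of a b] le[of b a] unfolding prime_ideal_def by blast
  qed
qed

section \<open>Formal sums in an MV-chain\<close>

context mv_chain
begin

definition less (infix "\<sqsubset>" 50) where "x \<sqsubset> y \<longleftrightarrow> x \<sqsubseteq> y \<and> x \<noteq> y"

text \<open>
  A pair \<open>(k, a)\<close> with \<open>a \<noteq> 1\<close> stands for the number \<open>k + a\<close> with integer part \<open>k\<close>.
\<close>

definition states where "states = {(k :: nat, a). a \<in> C \<and> a \<noteq> one A}"

text \<open>
  Addition of \<open>b\<close> to a state: on overflow of \<open>a \<oplus> b\<close> the integer part grows by one, and the remainder
  \<open>a + b - 1\<close> is \<open>a \<odot> b\<close>. Outside the chain and outside the states the function is the identity, so that
  the commutation law needed for folding over a multiset holds unconditionally.
\<close>

definition step where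
  "step b s = (if b \<in> C \<and> s \<in> states
    then (case s of (k, a) \<Rightarrow> if a \<oplus> b = one A then (Suc k, a \<odot> b) else (k, a \<oplus> b)) else s)"

definition msum where "msum M = fold_mset step (0 :: nat, zero A) M"

definition lex_less :: "nat \<times> 'a \<Rightarrow> nat \<times> 'a \<Rightarrow> bool" where
  "lex_less s t \<longleftrightarrow> fst s < fst t \<or> fst s = fst t \<and> snd s \<sqsubset> snd t"

text \<open>
  In a chain every sum either reaches \<open>1\<close> or does not overflow. This is where totality enters the
  arithmetic of carries.
\<close>

lemma proper_or_full: "x \<in> C \<Longrightarrow> y \<in> C \<Longrightarrow> x \<oplus> y \<noteq> one A \<Longrightarrow> x \<sqsubseteq> \<sim> y"
  by (metis neg_closed oplus_comm oplus_eq_one total)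

lemma odot_eq_diff2: "x \<in> C \<Longrightarrow> y \<in> C \<Longrightarrow> x \<odot> y = x \<ominus> \<sim> y"
  by (metis odot_comm odot_eq_diff)

lemma odot_neq_one: "x \<in> C \<Longrightarrow> y \<in> C \<Longrightarrow> x \<noteq> one A \<Longrightarrow> x \<odot> y \<noteq> one A"
  by (metis odot_comm odot_le one_le)

lemma step_simp:
  "a \<in> C \<Longrightarrow> a \<noteq> one A \<Longrightarrow> b \<in> C \<Longrightarrow>
    step b (k, a) = (if a \<oplus> b = one A then (Suc k, a \<odot> b) else (k, a \<oplus> b))"
  by (simp add: step_def states_def)

lemma step_states: "s \<in> states \<Longrightarrow> step b s \<in> states"
  by (auto simp: step_def states_def odot_neq_one split: if_splits)

text \<open>
  This identity and the next two equate the fractional parts of \<open>(a + b) + c\<close> and \<open>(a + c) + b\<close>: here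
  both first additions \<open>a + b\<close> and \<open>a + c\<close> carry (a second carry then occurs on both sides or on
  neither), in \<open>carry_proper\<close> only \<open>a + b\<close> does, and in
  \<open>proper_proper\<close> neither does, but the second additions do.
\<close>

lemma carry_carry:
  assumes C: "a \<in> C" "b \<in> C" "c \<in> C" and "a \<oplus> b = one A" "a \<oplus> c = one A"
  shows "a \<odot> b \<oplus> c = a \<odot> c \<oplus> b"
proof -
  let ?n = "\<sim> a"
  have n: "?n \<sqsubseteq> b" "?n \<sqsubseteq> c"
    using assms by (simp_all add: oplus_eq_one)
  have "(b \<ominus> ?n) \<oplus> ((c \<ominus> ?n) \<oplus> ?n) = (c \<ominus> ?n) \<oplus> ((b \<ominus> ?n) \<oplus> ?n)"
    using C by (simp add: oplus_ac)
  then show ?thesis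
    using C n by (simp add: diff_oplus odot_eq_diff)
qed

lemma carry_proper:
  assumes C: "a \<in> C" "b \<in> C" "c \<in> C" and ab: "a \<oplus> b = one A" and ac: "a \<sqsubseteq> \<sim> c"
  shows "a \<odot> b \<oplus> c = (a \<oplus> c) \<odot> b"
proof -
  let ?n = "\<sim> a" and ?d = "a \<odot> b"
  have n: "?n \<sqsubseteq> b"
    using assms by (simp add: oplus_eq_one)
  have c: "c \<sqsubseteq> ?n"
    using C ac by (metis neg_closed neg_le neg_neg)
  have compl: "\<sim> (a \<oplus> c) = ?n \<ominus> c"
    using C by (simp add: diff_def)
  have "(?d \<oplus> c) \<oplus> (?n \<ominus> c) = ?d \<oplus> ((?n \<ominus> c) \<oplus> c)"
    using C by (simp add: oplus_ac)
  also have "\<dots> = (b \<ominus> ?n) \<oplus> ?n"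
    using C c by (simp add: diff_oplus odot_eq_diff)
  also have "\<dots> = b"
    using C n by (simp add: diff_oplus)
  finally have sum: "(?d \<oplus> c) \<oplus> (?n \<ominus> c) = b" .
  have "?d \<sqsubseteq> a"
    using C by (metis odot_comm odot_le)
  then have "?d \<oplus> c \<sqsubseteq> a \<oplus> c"
    using C by (simp add: oplus_mono)
  then have "?d \<oplus> c \<sqsubseteq> \<sim> (?n \<ominus> c)"
    using C compl by (metis neg_neg oplus_closed)
  then have "?d \<oplus> c = b \<ominus> (?n \<ominus> c)"
    using C sum oplus_diff[of "?d \<oplus> c" "?n \<ominus> c"] by simp
  then show ?thesis
    using C compl by (simp add: odot_eq_diff[of "a \<oplus> c"])
qed

lemma proper_proper:
  assumes C: "a \<in> C" "b \<in> C" "c \<in> C" and ab: "a \<sqsubseteq> \<sim> b" and ac: "a \<sqsubseteq> \<sim> c"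
  shows "(a \<oplus> b) \<odot> c = (a \<oplus> c) \<odot> b"
proof -
  have split: "\<sim> x = (\<sim> x \<ominus> a) \<oplus> a" if "x \<in> C" "a \<sqsubseteq> \<sim> x" for x
    using C that by (simp add: diff_oplus)
  have neg_sum: "\<sim> (a \<oplus> x) = \<sim> x \<ominus> a" if "x \<in> C" for x
    using C that by (simp add: diff_def oplus_comm)
  have "(\<sim> b \<ominus> a) \<oplus> ((\<sim> c \<ominus> a) \<oplus> a) = (\<sim> c \<ominus> a) \<oplus> ((\<sim> b \<ominus> a) \<oplus> a)"
    using C by (simp add: oplus_ac)
  then have "\<sim> (a \<oplus> b) \<oplus> \<sim> c = \<sim> (a \<oplus> c) \<oplus> \<sim> b"
    using C ab ac split neg_sum by metis
  then show ?thesis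
    by (simp add: odot_def)
qed

lemma step_commute: "step b (step c s) = step c (step b s)"
proof (cases "b \<in> C \<and> c \<in> C \<and> s \<in> states")
  case False
  then show ?thesis
    using step_states by (auto simp: step_def)
next
  case True
  obtain k a where s: "s = (k, a)" by (cases s)
  have C: "a \<in> C" "b \<in> C" "c \<in> C" and a1: "a \<noteq> one A"
    using True s by (auto simp: states_def)
  have mixed: "step y (step x (k, a)) = step x (step y (k, a))"
    if "x \<in> C" "y \<in> C" and x: "a \<oplus> x = one A" and y: "a \<oplus> y \<noteq> one A" for x y
  proof -
    have "a \<odot> x \<oplus> y = (a \<oplus> y) \<odot> x"
      using C that proper_or_full by (intro carry_proper) auto
    moreover have "(a \<oplus> y) \<odot> x \<noteq> one A"
      using C that odot_neq_one by simp
    moreover have "(a \<oplus> y) \<oplus> x = one A"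
      using C that by (metis oplus_assoc oplus_comm one_oplus)
    ultimately show ?thesis
      using C a1 that odot_neq_one by (simp add: step_simp)
  qed
  consider "a \<oplus> b = one A" "a \<oplus> c = one A" | "a \<oplus> b = one A" "a \<oplus> c \<noteq> one A"
    | "a \<oplus> b \<noteq> one A" "a \<oplus> c = one A" | "a \<oplus> b \<noteq> one A" "a \<oplus> c \<noteq> one A"
    by blast
  then show ?thesis
  proof cases
    case 1
    moreover have "a \<odot> b \<oplus> c = a \<odot> c \<oplus> b"
      using C 1 by (rule carry_carry)
    moreover have "a \<odot> b \<odot> c = a \<odot> c \<odot> b"
      using C by (metis odot_assoc odot_comm)
    ultimately show ?thesis
      using C a1 odot_neq_one by (simp add: s step_simp)
  next
    case 2
    then show ?thesis using mixed[of b c] C s by simp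
  next
    case 3
    then show ?thesis using mixed[of c b] C s by simp
  next
    case 4
    then have "(a \<oplus> b) \<odot> c = (a \<oplus> c) \<odot> b"
      using C proper_or_full by (intro proper_proper) auto
    moreover have "a \<oplus> b \<oplus> c = a \<oplus> c \<oplus> b"
      using C by (simp add: oplus_ac)
    ultimately show ?thesis
      using C a1 4 by (simp add: s step_simp)
  qed
qed

interpretation step: comp_fun_commute step
  by unfold_locales (simp add: step_commute fun_eq_iff)

lemma msum_empty [simp]: "msum {#} = (0, zero A)"
  by (simp add: msum_def)

lemma msum_add_mset [simp]: "msum (add_mset b M) = step b (msum M)"
  by (simp add: msum_def)

text \<open>
  When the integer parts agree, the claim reduces to cancellation. When they differ by one and only the
  smaller state carries, the remainder \<open>a \<odot> b\<close> lies strictly below \<open>b\<close> since \<open>a \<noteq> 1\<close>.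
\<close>

lemma step_mono:
  assumes s: "s \<in> states" and t: "t \<in> states" and less: "lex_less s t"
  shows "lex_less (step b s) (step b t)"
proof (cases "b \<in> C")
  case False
  then show ?thesis using less by (simp add: step_def)
next
  case b: True
  obtain k a where sk: "s = (k, a)" by (cases s)
  obtain l a' where tl: "t = (l, a')" by (cases t)
  have C: "a \<in> C" "a' \<in> C" and ne: "a \<noteq> one A" "a' \<noteq> one A"
    using s t by (auto simp: sk tl states_def)
  consider "k = l" "a \<sqsubset> a'" | "k < l"
    using less by (auto simp: lex_less_def sk tl)
  then show ?thesis
  proof cases
    case 1
    then have aa': "a \<sqsubseteq> a'" "a \<noteq> a'"
      by (auto simp: less_def)
    have le: "a \<oplus> b \<sqsubseteq> a' \<oplus> b"
      using C b aa' by (simp add: oplus_mono)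
    consider "a \<oplus> b = one A" "a' \<oplus> b = one A" | "a \<oplus> b \<noteq> one A" "a' \<oplus> b = one A"
      | "a \<oplus> b \<noteq> one A" "a' \<oplus> b \<noteq> one A"
      using le C b one_le by fastforce
    then show ?thesis
    proof cases
      assume full: "a \<oplus> b = one A" "a' \<oplus> b = one A"
      then have "\<sim> b \<sqsubseteq> a" "\<sim> b \<sqsubseteq> a'"
        using C b by (simp_all add: oplus_comm flip: oplus_eq_one)
      then have "(a \<odot> b) \<oplus> \<sim> b = a" "(a' \<odot> b) \<oplus> \<sim> b = a'"
        using C b by (simp_all add: odot_eq_diff2 diff_oplus)
      then have "a \<odot> b \<noteq> a' \<odot> b"
        using aa' by metis
      moreover have "a \<odot> b \<sqsubseteq> a' \<odot> b"
        using C b aa' by (simp add: odot_eq_diff2 diff_mono)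
      ultimately show ?thesis
        using C b ne full 1 by (simp add: sk tl step_simp lex_less_def less_def)
    next
      assume "a \<oplus> b \<noteq> one A" "a' \<oplus> b = one A"
      then show ?thesis
        using C b ne 1 by (simp add: sk tl step_simp lex_less_def)
    next
      assume proper: "a \<oplus> b \<noteq> one A" "a' \<oplus> b \<noteq> one A"
      then have "(a \<oplus> b) \<ominus> b = a" "(a' \<oplus> b) \<ominus> b = a'"
        using C b proper_or_full by (simp_all add: oplus_diff)
      then have "a \<oplus> b \<noteq> a' \<oplus> b"
        using aa' by metis
      then show ?thesis
        using C b ne proper 1 le by (simp add: sk tl step_simp lex_less_def less_def)
    qed
  next
    case 2
    have "a \<odot> b \<sqsubset> a' \<oplus> b" if full: "a \<oplus> b = one A"
    proof -
      have le: "a \<odot> b \<sqsubseteq> b" "b \<sqsubseteq> a' \<oplus> b"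
        using C b by (simp_all add: odot_le)
      have "a \<odot> b \<noteq> b"
      proof
        assume "a \<odot> b = b"
        moreover have "b \<ominus> (b \<ominus> \<sim> a) = \<sim> a"
          using C b full by (intro diff_diff) (auto simp: oplus_eq_one)
        ultimately have "\<sim> a = b \<ominus> b"
          using C b by (simp add: odot_eq_diff)
        also have "\<dots> = zero A"
          using b by (simp add: diff_eq_zero)
        finally show False
          using C ne by (metis neg_neg neg_zero)
      qed
      then have "a \<odot> b \<noteq> a' \<oplus> b"
        using le C b by (metis le_antisym odot_closed)
      moreover have "a \<odot> b \<sqsubseteq> a' \<oplus> b"
        using le C b by (meson le_trans odot_closed oplus_closed)
      ultimately show ?thesis
        by (simp add: less_def)
    qed
    then show ?thesis
      using 2 C b ne by (cases "Suc k = l") (auto simp: sk tl step_simp lex_less_def)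
  qed
qed

lemma msum_states: "zero A \<noteq> one A \<Longrightarrow> msum M \<in> states"
  by (induction M) (auto simp: step_states, auto simp: states_def)

lemma msum_less_add:
  assumes "zero A \<noteq> one A" "lex_less (msum M) (msum N)"
  shows "lex_less (msum (M + L)) (msum (N + L))"
  using assms by (induction L) (auto intro: step_mono msum_states)

lemma msum_eq_add: "msum M = msum N \<Longrightarrow> msum (M + L) = msum (N + L)"
  by (induction L) auto

lemma lex_less_trans:
  assumes "s \<in> states" "t \<in> states" "u \<in> states" "lex_less s t" "lex_less t u"
  shows "lex_less s u"
proof -
  have "snd s \<in> C" "snd t \<in> C" "snd u \<in> C"
    using assms by (auto simp: states_def)
  then have "snd s \<sqsubset> snd u" if "snd s \<sqsubset> snd t" "snd t \<sqsubset> snd u"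
    using that unfolding less_def by (metis le_antisym le_trans)
  then show ?thesis
    using assms(4,5) by (auto simp: lex_less_def)
qed

lemma lex_less_total: "s \<in> states \<Longrightarrow> t \<in> states \<Longrightarrow> lex_less s t \<or> s = t \<or> lex_less t s"
  using total by (cases s; cases t) (auto simp: lex_less_def less_def states_def)

lemma lex_less_irrefl: "\<not> lex_less s s"
  by (simp add: lex_less_def less_def)

end

section \<open>Rational solutions of finite systems of linear inequalities\<close>

text \<open>
  One relation covers strict and non-strict inequalities; combining two constraints combines their flags
  by disjunction.
\<close>

abbreviation below :: "bool \<Rightarrow> rat \<Rightarrow> rat \<Rightarrow> bool" where
  "below strict l u \<equiv> (if strict then l < u else l \<le> u)"

text \<open>
  If both kinds of bounds occur, the midpoint of the greatest lower bound and the least upper bound works. If the two coincide, no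
  lower or upper bound attaining that value is strict.
\<close>

lemma between_bounds:
  fixes L U :: "(bool \<times> rat) set"
  assumes fin: "finite L" "finite U"
    and LU: "\<And>s l t u. (s, l) \<in> L \<Longrightarrow> (t, u) \<in> U \<Longrightarrow> below (s \<or> t) l u"
  shows "\<exists>r. (\<forall>(s, l)\<in>L. below s l r) \<and> (\<forall>(t, u)\<in>U. below t r u)"
proof -
  consider "L = {}" | "U = {}" | "L \<noteq> {}" "U \<noteq> {}" by blast
  then show ?thesis
  proof cases
    case 1
    have "bdd_below (snd ` U)" using fin by simp
    then obtain m where "\<forall>x\<in>snd ` U. m \<le> x"
      by (auto simp: bdd_below_def)
    moreover obtain m' where "m' < m"
      using lt_ex by blast
    ultimately have "\<forall>x\<in>snd ` U. m' < x"
      by (meson less_le_trans)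
    then show ?thesis using 1 by (intro exI[of _ m']) force
  next
    case 2
    have "bdd_above (snd ` L)" using fin by simp
    then obtain m where "\<forall>x\<in>snd ` L. x \<le> m"
      by (auto simp: bdd_above_def)
    moreover obtain m' where "m < m'"
      using gt_ex by blast
    ultimately have "\<forall>x\<in>snd ` L. x < m'"
      by (meson le_less_trans)
    then show ?thesis using 2 by (intro exI[of _ m']) force
  next
    case 3
    define l where "l = Max (snd ` L)"
    define u where "u = Min (snd ` U)"
    have l: "x \<le> l" if "(s, x) \<in> L" for s x
      unfolding l_def using that fin by (intro Max_ge) force+
    have u: "u \<le> x" if "(s, x) \<in> U" for s x
      unfolding u_def using that fin by (intro Min_le) force+
    have "l \<in> snd ` L" "u \<in> snd ` U"
      unfolding l_def u_def using 3 fin by auto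
    then obtain s t where st: "(s, l) \<in> L" "(t, u) \<in> U"
      by auto
    have "l \<le> u"
      using LU[OF st] by (auto split: if_splits)
    have "below s' x ((l + u) / 2)" if "(s', x) \<in> L" for s' x
      using l[OF that] LU[OF that st(2)] \<open>l \<le> u\<close> by (auto split: if_splits)
    moreover have "below t' ((l + u) / 2) x" if "(t', x) \<in> U" for t' x
      using u[OF that] LU[OF st(1) that] \<open>l \<le> u\<close> by (auto split: if_splits)
    ultimately show ?thesis
      by (intro exI[of _ "(l + u) / 2"]) blast
  qed
qed

lemma below_quotients_iff:
  fixes A B :: rat
  assumes "0 < A" "B < 0"
  shows "below s (- a / A) (- b / B) \<longleftrightarrow> below s 0 (- B * a + A * b)"
proof -
  have "- b / B = b / (- B)" by simp
  moreover have "- a / A < b / (- B) \<longleftrightarrow> - a * (- B) < b * A"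
    using assms by (simp only: pos_divide_less_eq pos_less_divide_eq times_divide_eq_left neg_0_less_iff_less)
  moreover have "- a / A \<le> b / (- B) \<longleftrightarrow> - a * (- B) \<le> b * A"
    using assms by (simp only: pos_divide_le_eq pos_le_divide_eq times_divide_eq_left neg_0_less_iff_less)
  ultimately show ?thesis
    by (auto simp: algebra_simps)
qed

text \<open>
  Fourier-Motzkin elimination. \<open>T\<close> is any collection of (possibly strict) homogeneous linear inequalities
  closed under addition and not containing \<open>0 < 0\<close>; a finite part \<open>K\<close> of it has a rational solution.
  To eliminate a variable \<open>z\<close>, each inequality bounding \<open>z\<close> from below is combined with each bounding it
  from above. The combinations stay in \<open>T\<close>, and a solution of them leaves room for a value of \<open>z\<close>.
\<close>

lemma rational_solution:
  fixes T :: "bool \<Rightarrow> ('v \<Rightarrow> int) \<Rightarrow> bool" and K :: "(bool \<times> ('v \<Rightarrow> int)) set"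
  assumes add: "\<And>s t a b. T s a \<Longrightarrow> T t b \<Longrightarrow> T (s \<or> t) (\<lambda>x. a x + b x)"
    and nonzero: "\<not> T True (\<lambda>x. 0)"
    and "finite X" "finite K"
    and "\<And>s a. (s, a) \<in> K \<Longrightarrow> T s a"
    and "\<And>s a x. (s, a) \<in> K \<Longrightarrow> x \<notin> X \<Longrightarrow> a x = 0"
  shows "\<exists>q :: 'v \<Rightarrow> rat. \<forall>(s, a)\<in>K. below s 0 (\<Sum>x\<in>X. of_int (a x) * q x)"
  using assms(3-)
proof (induction X arbitrary: K rule: finite_induct)
  case empty
  have "s = False" if "(s, a) \<in> K" for s a
  proof -
    have "a = (\<lambda>x. 0)" using empty(3)[OF that] by auto
    then show ?thesis using empty(2)[OF that] nonzero by (cases s) auto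
  qed
  then show ?case by auto
next
  case (insert z X)
  have scale: "T s (\<lambda>x. int (Suc n) * a x)" if "T s a" for s a n
  proof (induction n)
    case (Suc n)
    show ?case using add[OF that Suc] by (simp add: algebra_simps)
  qed (use that in simp)
  have pos_scale: "T s (\<lambda>x. k * a x)" if "T s a" "0 < k" for s a k
    using scale[OF that(1), of "nat k - 1"] that(2) by (simp add: of_nat_diff)
  define comb where "comb = (\<lambda>(s, a) (t, b). (s \<or> t, \<lambda>x. - b z * a x + a z * b x :: int))"
  define L where "L = {(s, a) \<in> K. 0 < a z}"
  define U where "U = {(s, a) \<in> K. a z < 0}"
  define K' where "K' = {(s, a) \<in> K. a z = 0} \<union> (\<lambda>(l, u). comb l u) ` (L \<times> U)"
  have fin: "finite L" "finite U"
    using insert.prems(1) by (auto simp: L_def U_def intro: rev_finite_subset)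
  have "finite K'"
    using fin insert.prems(1) by (auto simp: K'_def intro: rev_finite_subset)
  moreover have "T s a" if "(s, a) \<in> K'" for s a
  proof -
    { fix s' a' t b assume ab: "(s', a') \<in> L" "(t, b) \<in> U" and eq: "(s, a) = comb (s', a') (t, b)"
      have "T (s' \<or> t) (\<lambda>x. - b z * a' x + a' z * b x)"
        using ab insert.prems(2) by (intro add pos_scale) (auto simp: L_def U_def)
      then have ?thesis using eq by (simp add: comb_def) }
    then show ?thesis
      using that insert.prems(2) by (auto simp: K'_def)
  qed
  moreover have "a x = 0" if "(s, a) \<in> K'" "x \<notin> X" for s a x
  proof (cases "x = z")
    case True
    then show ?thesis using that by (auto simp: K'_def comb_def L_def U_def)
  next
    case False
    then have b0: "b x = 0" if "(t, b) \<in> K" for t b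
      using insert.prems(3)[OF that] \<open>x \<notin> X\<close> by simp
    from that(1) consider "(s, a) \<in> K"
      | t b u c where "(t, b) \<in> K" "(u, c) \<in> K" "a = (\<lambda>x. - c z * b x + b z * c x)"
      by (auto simp: K'_def comb_def L_def U_def)
    then show ?thesis
      by cases (auto simp: b0)
  qed
  ultimately obtain q :: "'v \<Rightarrow> rat" 
    where q: "\<And>s a. (s, a) \<in> K' \<Longrightarrow> below s 0 (\<Sum>x\<in>X. of_int (a x) * q x)"
    using insert.IH[of K'] by blast
  define rest :: "('v \<Rightarrow> int) \<Rightarrow> rat" where "rest a = (\<Sum>x\<in>X. of_int (a x) * q x)" for a
  have rest_comb: "rest (snd (comb (s, a) (t, b))) = - of_int (b z) * rest a + of_int (a z) * rest b" for s a t b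
    by (simp add: rest_def comb_def sum_distrib_left sum.distrib[symmetric] algebra_simps)
  define bound where "bound = (\<lambda>(s :: bool, a). (s, - rest a / of_int (a z)))"
  have "\<exists>r. (\<forall>(s, l)\<in>bound ` L. below s l r) \<and> (\<forall>(t, u)\<in>bound ` U. below t r u)"
  proof (rule between_bounds)
    fix s l t u assume "(s, l) \<in> bound ` L" "(t, u) \<in> bound ` U"
    then obtain a b where ab: "(s, a) \<in> L" "(t, b) \<in> U"
      and lu: "l = - rest a / of_int (a z)" "u = - rest b / of_int (b z)"
      by (auto simp: bound_def)
    then have "(s \<or> t, snd (comb (s, a) (t, b))) \<in> K'"
      by (force simp: K'_def comb_def)
    from q[OF this] have "below (s \<or> t) 0 (- of_int (b z) * rest a + of_int (a z) * rest b)"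
      unfolding rest_comb[of s a t b, symmetric] unfolding rest_def .
    moreover have "0 < (of_int (a z) :: rat)" "(of_int (b z) :: rat) < 0"
      using ab by (auto simp: L_def U_def)
    ultimately show "below (s \<or> t) l u"
      unfolding lu by (simp only: below_quotients_iff)
  qed (use fin in auto)
  then obtain r where r: "(\<forall>(s, l)\<in>bound ` L. below s l r) \<and> (\<forall>(t, u)\<in>bound ` U. below t r u)"
    ..
  have rL: "below s l r" if "(s, l) \<in> bound ` L" for s l
    using bspec[OF conjunct1[OF r] that] by simp
  have rU: "below t r u" if "(t, u) \<in> bound ` U" for t u
    using bspec[OF conjunct2[OF r] that] by simp
  define q' where "q' = q(z := r)"
  have sum: "(\<Sum>x\<in>insert z X. of_int (a x) * q' x) = of_int (a z) * r + rest a" for a :: "'v \<Rightarrow> int"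
  proof -
    have "(\<Sum>x\<in>X. of_int (a x) * q' x) = rest a"
      unfolding rest_def using insert.hyps by (intro sum.cong) (auto simp: q'_def)
    then show ?thesis
      using insert.hyps by (simp add: q'_def)
  qed
  have "below s 0 (of_int (a z) * r + rest a)" if "(s, a) \<in> K" for s a
  proof -
    consider "a z = 0" | "0 < a z" | "a z < 0" by linarith
    then show ?thesis
    proof cases
      case 1
      then have "(s, a) \<in> K'" using that by (simp add: K'_def)
      from q[OF this] 1 show ?thesis by (simp add: rest_def)
    next
      case 2
      then have "below s (- rest a / of_int (a z)) r"
        using that by (intro rL) (auto simp: L_def bound_def image_iff intro!: bexI[of _ "(s, a)"])
      moreover have "0 < (of_int (a z) :: rat)" using 2 by simp
      ultimately show ?thesis by (simp add: pos_minus_divide_less_eq pos_minus_divide_le_eq algebra_simps split: if_splits)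
    next
      case 3
      then have "below s r (- rest a / of_int (a z))"
        using that by (intro rU) (auto simp: U_def bound_def image_iff intro!: bexI[of _ "(s, a)"])
      moreover have "(of_int (a z) :: rat) < 0" using 3 by simp
      ultimately show ?thesis by (simp add: neg_less_minus_divide_eq neg_le_minus_divide_eq algebra_simps split: if_splits)
    qed
  qed
  then show ?case
    unfolding sum[symmetric] by (intro exI[of _ q']) blast
qed

text \<open>
  A comparison \<open>M \<le> N\<close> of multisets is read as the linear inequality whose coefficients are the
  differences of multiplicities. Additivity of the relations is closure under addition of inequalities,
  and irreflexivity excludes \<open>0 < 0\<close>, as coefficients that all vanish mean \<open>M = N\<close>.
\<close>

lemma rational_weights:
  fixes LE LT :: "'v multiset \<Rightarrow> 'v multiset \<Rightarrow> bool" and K :: "('v multiset \<times> 'v multiset) set"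
  assumes le_add: "\<And>M N M' N'. LE M N \<Longrightarrow> LE M' N' \<Longrightarrow> LE (M + M') (N + N')"
    and lt_add: "\<And>M N M' N'. LT M N \<Longrightarrow> LE M' N' \<Longrightarrow> LT (M + M') (N + N')"
    and lt_le: "\<And>M N. LT M N \<Longrightarrow> LE M N"
    and lt_irrefl: "\<And>M. \<not> LT M M"
    and K: "finite K"
  shows "\<exists>q :: 'v \<Rightarrow> rat. \<forall>(M, N)\<in>K. (LE M N \<longrightarrow> (\<Sum>x\<in>#M. q x) \<le> (\<Sum>x\<in>#N. q x)) \<and>
    (LT M N \<longrightarrow> (\<Sum>x\<in>#M. q x) < (\<Sum>x\<in>#N. q x))"
proof -
  define form where "form M N = (\<lambda>x :: 'v. int (count N x) - int (count M x))" for M N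
  define rel where "rel s = (if s then LT else LE)" for s
  define T where "T s a \<longleftrightarrow> (\<exists>M N. a = form M N \<and> rel s M N)" for s a
  define X where "X = (\<Union>(M, N)\<in>K. set_mset M \<union> set_mset N)"
  define F where "F = (\<lambda>(s, M, N). (s, form M N)) ` {(s, M, N). (M, N) \<in> K \<and> rel s M N}"
  have X: "finite X"
    using K by (auto simp: X_def)
  have sum: "(\<Sum>x\<in>X. of_int (form M N x) * q x) = (\<Sum>x\<in>#N. q x) - (\<Sum>x\<in>#M. q x)"
    if "(M, N) \<in> K" for M N and q :: "'v \<Rightarrow> rat"
  proof -
    have *: "(\<Sum>x\<in>#L. q x) = (\<Sum>x\<in>X. of_nat (count L x) * q x)" if "set_mset L \<subseteq> X" for L
      using that
    proof (induction L)
      case (add y L)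
      then have "(\<Sum>x\<in>X. of_nat (count (add_mset y L) x) * q x)
          = (\<Sum>x\<in>X. (if x = y then q x else 0) + of_nat (count L x) * q x)"
        by (intro sum.cong) (auto simp: algebra_simps)
      then show ?case
        using add X by (simp add: sum.distrib)
    qed simp
    have "set_mset M \<subseteq> X" "set_mset N \<subseteq> X"
      using that by (auto simp: X_def)
    then show ?thesis
      by (simp add: * form_def left_diff_distrib sum_subtractf)
  qed
  have "\<exists>q :: 'v \<Rightarrow> rat. \<forall>(s, a)\<in>F. below s 0 (\<Sum>x\<in>X. of_int (a x) * q x)"
  proof (rule rational_solution[where T = T])
    fix s t a b assume "T s a" "T t b"
    then obtain M N M' N' where *: "a = form M N" "rel s M N" "b = form M' N'" "rel t M' N'"
      by (auto simp: T_def)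
    then have "rel (s \<or> t) (M + M') (N + N')"
      using le_add[of M N M' N'] lt_add[of M N M' N'] lt_add[of M' N' M N] lt_le
      by (auto simp: rel_def add.commute split: if_splits)
    moreover have "(\<lambda>x. a x + b x) = form (M + M') (N + N')"
      using * by (auto simp: form_def)
    ultimately show "T (s \<or> t) (\<lambda>x. a x + b x)"
      unfolding T_def by blast
  next
    have "M = N" if "(\<lambda>x. 0) = form M N" for M N
      using that by (auto simp: form_def fun_eq_iff intro: multiset_eqI)
    then show "\<not> T True (\<lambda>x. 0)"
      using lt_irrefl by (auto simp: T_def rel_def)
  next
    have "{(s, M, N). (M, N) \<in> K \<and> rel s M N} \<subseteq> UNIV \<times> K" by auto
    then show "finite F"
      unfolding F_def using K by (meson finite_SigmaI finite_imageI finite_subset finite)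
  next
    show "T s a" if "(s, a) \<in> F" for s a
      using that by (auto simp: F_def T_def)
    show "a x = 0" if "(s, a) \<in> F" "x \<notin> X" for s a x
      using that by (fastforce simp: F_def X_def form_def not_in_iff)
  qed (fact X)
  then obtain q :: "'v \<Rightarrow> rat" where q: "\<And>s a. (s, a) \<in> F \<Longrightarrow> below s 0 (\<Sum>x\<in>X. of_int (a x) * q x)"
    by blast
  have "below s 0 ((\<Sum>x\<in>#N. q x) - (\<Sum>x\<in>#M. q x))" if "(M, N) \<in> K" "rel s M N" for s M N
    using q[of s "form M N"] that sum[OF that(1)] by (force simp: F_def)
  from this[of _ _ False] this[of _ _ True] show ?thesis
    by (intro exI[of _ q]) (auto simp: rel_def)
qed

section \<open>Rational embeddings of finite parts of MV-chains\<close>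

context mv_chain
begin

context
  assumes nontrivial: "zero A \<noteq> one A"
begin

lemma msum_single: "x \<in> C \<Longrightarrow> msum {#x#} = (if x = one A then (1, zero A) else (0, x))"
  using nontrivial by (simp add: step_simp odot_def)

text \<open>
  Sums in the chain that do not overflow agree with formal sums. Together with \<open>msum_pair_full\<close> this turns
  every relation among chain elements into a comparison of formal sums.
\<close>

lemma msum_pair_proper:
  assumes C: "x \<in> C" "y \<in> C" and proper: "x \<odot> y = zero A"
  shows "msum {#x, y#} = msum {#x \<oplus> y#}"
proof (cases "y = one A")
  case True
  then have "x = zero A"
    using C proper by (simp add: odot_eq_diff diff_def)
  then show ?thesis
    using True nontrivial by (simp add: step_simp odot_def)
next
  case False
  then have "msum {#x, y#} = step x (0, y)"
    using C msum_single[of y] by simp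
  then show ?thesis
    using C False proper nontrivial msum_single[of "x \<oplus> y"]
    by (simp add: step_simp oplus_comm[of y] odot_comm[of y])
qed

lemma msum_pair_full:
  assumes C: "x \<in> C" "y \<in> C" and full: "x \<oplus> y = one A"
  shows "msum {#one A#} = msum {#x, y#} \<or> lex_less (msum {#one A#}) (msum {#x, y#})"
proof -
  have "snd (msum {#x, y#}) \<in> C"
    using msum_states[OF nontrivial, of "{#x, y#}"] by (auto simp: states_def)
  moreover have "1 \<le> fst (msum {#x, y#})"
  proof (cases "y = one A")
    case True
    then have "msum {#x, y#} = step x (1, zero A)"
      using msum_single[of y] by simp
    then show ?thesis
      using C nontrivial by (simp add: step_simp)
  next
    case False
    then have "msum {#x, y#} = step x (0, y)"
      using C msum_single[of y] by simp
    then show ?thesis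
      using C False full by (simp add: step_simp oplus_comm[of y])
  qed
  moreover have "msum {#one A#} = (1, zero A)"
    by (simp add: msum_single del: msum_add_mset)
  ultimately show ?thesis
    by (cases "msum {#x, y#}") (auto simp: lex_less_def less_def simp del: msum_add_mset)
qed

lemma msum_replicate:
  assumes x: "x \<in> C" and "x \<odot> ndot A (n - 1) x = zero A"
  shows "msum (replicate_mset n x) = msum {#ndot A n x#}"
  using assms(2)
proof (induction n)
  case 0
  then show ?case
    using nontrivial msum_single[of "zero A"] by simp
next
  case (Suc n)
  then have le: "x \<sqsubseteq> \<sim> (ndot A n x)"
    using x by (simp add: odot_eq_zero)
  moreover have "\<sim> (ndot A n x) \<sqsubseteq> \<sim> (ndot A (n - 1) x)"
    using x by (simp add: neg_le ndot_mono)
  ultimately have "x \<sqsubseteq> \<sim> (ndot A (n - 1) x)"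
    using x by (meson le_trans neg_closed ndot_closed)
  then have "msum (replicate_mset n x) = msum {#ndot A n x#}"
    using x Suc.IH by (simp add: odot_eq_zero)
  then have "msum (replicate_mset (Suc n) x) = msum {#x, ndot A n x#}"
    by simp
  also have "\<dots> = msum {#x \<oplus> ndot A n x#}"
    using x le by (intro msum_pair_proper) (auto simp: odot_eq_zero)
  finally show ?case
    using x by (simp add: oplus_comm[of x])
qed

lemma order_preserving_weights:
  assumes "finite K"
  shows "\<exists>q :: 'a \<Rightarrow> rat. \<forall>(M, N)\<in>K.
    (msum M = msum N \<longrightarrow> (\<Sum>x\<in>#M. q x) = (\<Sum>x\<in>#N. q x)) \<and>
    (lex_less (msum M) (msum N) \<longrightarrow> (\<Sum>x\<in>#M. q x) < (\<Sum>x\<in>#N. q x))"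
proof -
  define LT where "LT M N = lex_less (msum M) (msum N)" for M N
  define LE where "LE M N \<longleftrightarrow> LT M N \<or> msum M = msum N" for M N
  have LT_trans: "LT M L" if "LT M N" "LT N L" for M N L
    using that lex_less_trans msum_states[OF nontrivial] unfolding LT_def by blast
  have LT_add: "LT (M + L) (N + L)" "LT (L + M) (L + N)" if "LT M N" for M N L
    using that msum_less_add[OF nontrivial] by (auto simp: LT_def add.commute[of L])
  have LE_add: "LE (L + M) (L + N)" if "LE M N" for M N L
    using that LT_add msum_eq_add[of M N L] by (auto simp: LE_def add.commute[of L])
  have LT_LE: "LT M L" if "LT M N" "LE N L" for M N L
    using that LT_trans by (auto simp: LE_def LT_def)
  \<comment> \<open>An equality amounts to two opposite non-strict comparisons, hence the converse pairs.\<close>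
  have "\<exists>q :: 'a \<Rightarrow> rat. \<forall>(M, N)\<in>K \<union> K\<inverse>. (LE M N \<longrightarrow> (\<Sum>x\<in>#M. q x) \<le> (\<Sum>x\<in>#N. q x)) \<and>
    (LT M N \<longrightarrow> (\<Sum>x\<in>#M. q x) < (\<Sum>x\<in>#N. q x))"
  proof (rule rational_weights)
    show lt: "LT (M + M') (N + N')" if "LT M N" "LE M' N'" for M N M' N'
      using LT_LE[OF LT_add(1)[OF that(1)] LE_add[OF that(2)]] .
    show "LE (M + M') (N + N')" if "LE M N" "LE M' N'" for M N M' N'
    proof (cases "LT M N")
      case True
      then show ?thesis using lt that by (simp add: LE_def)
    next
      case False
      then have "msum (M + M') = msum (N + M')"
        using that by (auto simp: LE_def intro: msum_eq_add)
      then show ?thesis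
        using LE_add[OF that(2), of N] by (auto simp: LE_def LT_def)
    qed
  qed (use assms in \<open>auto simp: LE_def LT_def lex_less_irrefl\<close>)
  then obtain q :: "'a \<Rightarrow> rat" where
    q: "\<And>M N. (M, N) \<in> K \<union> K\<inverse> \<Longrightarrow> (LE M N \<longrightarrow> (\<Sum>x\<in>#M. q x) \<le> (\<Sum>x\<in>#N. q x)) \<and>
      (LT M N \<longrightarrow> (\<Sum>x\<in>#M. q x) < (\<Sum>x\<in>#N. q x))"
    by (auto simp only: split_paired_all case_prod_conv Ball_def)
  have "(\<Sum>x\<in>#M. q x) = (\<Sum>x\<in>#N. q x)" if "(M, N) \<in> K" "msum M = msum N" for M N
    using q[of M N] q[of N M] that by (intro antisym) (simp_all add: LE_def)
  moreover have "(\<Sum>x\<in>#M. q x) < (\<Sum>x\<in>#N. q x)" if "(M, N) \<in> K" "lex_less (msum M) (msum N)" for M N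
    using q[of M N] that by (simp add: LT_def)
  ultimately show ?thesis
    by (intro exI[of _ q]) blast
qed

text \<open>
  Each property to be preserved is an equality or a comparison of formal sums of at most \<open>max 2 m\<close>
  elements of \<open>X \<union> {0, 1}\<close>. There are finitely many such sums, so suitable rational weights exist; dividing
  them by the weight of \<open>1\<close> gives the map.
\<close>

lemma rational_embedding:
  assumes X: "finite X" "X \<subseteq> C"
  shows "\<exists>f :: 'a \<Rightarrow> rat. f (zero A) = 0 \<and> f (one A) = 1 \<and> (\<forall>x\<in>X. 0 \<le> f x \<and> f x \<le> 1) \<and>
    inj_on f X \<and>
    (\<forall>x\<in>X. \<sim> x \<in> X \<longrightarrow> f (\<sim> x) = 1 - f x) \<and>
    (\<forall>x\<in>X. \<forall>y\<in>X. x \<oplus> y \<in> X \<longrightarrow> f (x \<oplus> y) = min 1 (f x + f y)) \<and>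
    (\<forall>x\<in>X. \<forall>n\<le>m. x \<odot> ndot A (n - 1) x = zero A \<longrightarrow> ndot A n x \<in> X \<longrightarrow>
      f (ndot A n x) = of_nat n * f x)"
proof -
  define Y where "Y = insert (zero A) (insert (one A) X)"
  \<comment> \<open>The bound \<open>m + 2\<close> leaves room for pairs as well as for \<open>m\<close> copies of one element.\<close>
  define \<M> where "\<M> = {M. set_mset M \<subseteq> Y \<and> size M \<le> m + 2}"
  have Y: "finite Y" "Y \<subseteq> C" "X \<subseteq> Y" "zero A \<in> Y" "one A \<in> Y"
    using X by (auto simp: Y_def)
  have YC: "x \<in> C" if "x \<in> Y" for x
    using that Y by blast
  have "\<M> = (\<Union>n\<le>m + 2. {M. set_mset M \<subseteq> Y \<and> size M = n})"
    by (auto simp: \<M>_def)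
  then have "finite \<M>"
    using finite_multisets_of_size[OF Y(1)] by (simp add: multisets_of_size_def)
  then obtain q :: "'a \<Rightarrow> rat" where "\<forall>(M, N)\<in>\<M> \<times> \<M>.
    (msum M = msum N \<longrightarrow> (\<Sum>x\<in>#M. q x) = (\<Sum>x\<in>#N. q x)) \<and>
    (lex_less (msum M) (msum N) \<longrightarrow> (\<Sum>x\<in>#M. q x) < (\<Sum>x\<in>#N. q x))"
    using order_preserving_weights[of "\<M> \<times> \<M>"] by blast
  then have eq: "\<And>M N. M \<in> \<M> \<Longrightarrow> N \<in> \<M> \<Longrightarrow> msum M = msum N \<Longrightarrow> (\<Sum>x\<in>#M. q x) = (\<Sum>x\<in>#N. q x)"
    and less: "\<And>M N. M \<in> \<M> \<Longrightarrow> N \<in> \<M> \<Longrightarrow> lex_less (msum M) (msum N) \<Longrightarrow> (\<Sum>x\<in>#M. q x) < (\<Sum>x\<in>#N. q x)"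
    by blast+
  have in_M [simp]: "{#} \<in> \<M>" "x \<in> Y \<Longrightarrow> {#x#} \<in> \<M>" "x \<in> Y \<Longrightarrow> y \<in> Y \<Longrightarrow> {#x, y#} \<in> \<M>"
    "x \<in> Y \<Longrightarrow> n \<le> m \<Longrightarrow> replicate_mset n x \<in> \<M>" for x y n
    by (auto simp: \<M>_def split: if_splits)
  have single: "msum {#x#} = (if x = one A then (1, zero A) else (0, x))" if "x \<in> Y" for x
    using msum_single[of x] that Y by blast
  have zero: "q (zero A) = 0"
    using eq[of "{#zero A#}" "{#}"] nontrivial Y msum_single[of "zero A"] by simp
  have pos: "0 < q (one A)"
    using less[of "{#}" "{#one A#}"] Y msum_single[of "one A"] by (simp add: lex_less_def)
  have nonneg: "0 \<le> q x" if "x \<in> Y" for x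
  proof (cases "x = zero A")
    case False
    then have "lex_less (msum {#}) (msum {#x#})"
      using that Y by (auto simp: single lex_less_def less_def simp del: msum_add_mset)
    then show ?thesis
      using less[of "{#}" "{#x#}"] that by simp
  qed (simp add: zero)
  have le_one: "q x \<le> q (one A)" if "x \<in> Y" for x
  proof (cases "x = one A")
    case False
    then have "lex_less (msum {#x#}) (msum {#one A#})"
      using that Y by (simp add: single lex_less_def del: msum_add_mset)
    then show ?thesis
      using less[of "{#x#}" "{#one A#}"] that Y by simp
  qed simp
  have inj: "x = y" if xy: "x \<in> Y" "y \<in> Y" "q x = q y" for x y
  proof -
    have "\<not> lex_less (msum {#x#}) (msum {#y#})" "\<not> lex_less (msum {#y#}) (msum {#x#})"
      using less[of "{#x#}" "{#y#}"] less[of "{#y#}" "{#x#}"] xy by auto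
    then have "msum {#x#} = msum {#y#}"
      using lex_less_total msum_states[OF nontrivial] by blast
    then show ?thesis
      using xy nontrivial by (simp add: single split: if_splits del: msum_add_mset)
  qed
  have proper: "q (x \<oplus> y) = q x + q y" if "x \<in> Y" "y \<in> Y" "x \<oplus> y \<in> Y" "x \<odot> y = zero A" for x y
    using eq[of "{#x, y#}" "{#x \<oplus> y#}"] msum_pair_proper[of x y] that by (simp add: YC)
  have full: "q (one A) \<le> q x + q y" if "x \<in> Y" "y \<in> Y" "x \<oplus> y = one A" for x y
    using eq[of "{#one A#}" "{#x, y#}"] less[of "{#one A#}" "{#x, y#}"] msum_pair_full[of x y] that Y
    by (auto simp: YC simp del: msum_add_mset)
  have neg: "q (\<sim> x) = q (one A) - q x" if "x \<in> Y" "\<sim> x \<in> Y" for x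
  proof -
    have "x \<in> C" "x \<odot> \<sim> x = zero A"
      using that by (simp_all add: YC odot_def)
    then show ?thesis
      using proper[of x "\<sim> x"] that Y by simp
  qed
  have oplus: "q (x \<oplus> y) = min (q (one A)) (q x + q y)" if xy: "x \<in> Y" "y \<in> Y" "x \<oplus> y \<in> Y" for x y
  proof (cases "x \<oplus> y = one A")
    case True
    then show ?thesis using full[of x y] xy by simp
  next
    case False
    then have "x \<odot> y = zero A"
      using proper_or_full[of x y] xy by (simp add: YC odot_eq_zero)
    then show ?thesis
      using proper[of x y] le_one[of "x \<oplus> y"] xy by simp
  qed
  have multiple: "q (ndot A n x) = of_nat n * q x"
    if "x \<in> Y" "n \<le> m" "x \<odot> ndot A (n - 1) x = zero A" "ndot A n x \<in> Y" for n x
    using eq[of "replicate_mset n x" "{#ndot A n x#}"] msum_replicate[of x n] that by (simp add: YC del: msum_add_mset)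
  have XY: "x \<in> Y" if "x \<in> X" for x
    using that Y by blast
  define f where "f x = q x / q (one A)" for x
  have "f (x \<oplus> y) = min 1 (f x + f y)" if "x \<in> X" "y \<in> X" "x \<oplus> y \<in> X" for x y
    using oplus[of x y] that pos by (simp add: XY f_def min_def field_simps)
  moreover have "f (\<sim> x) = 1 - f x" if "x \<in> X" "\<sim> x \<in> X" for x
    using neg[of x] that pos by (simp add: XY f_def field_simps)
  moreover have "0 \<le> f x \<and> f x \<le> 1" if "x \<in> X" for x
    using nonneg[of x] le_one[of x] that pos by (simp add: XY f_def)
  moreover have "inj_on f X"
    using inj pos by (simp add: XY f_def inj_on_def)
  moreover have "f (ndot A n x) = of_nat n * f x"
    if "x \<in> X" "n \<le> m" "x \<odot> ndot A (n - 1) x = zero A" "ndot A n x \<in> X" for n x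
    using multiple[of x n] that by (simp add: XY f_def)
  moreover have "f (zero A) = 0" "f (one A) = 1"
    using zero pos by (auto simp: f_def)
  ultimately show ?thesis
    by (intro exI[of _ f]) blast
qed

end
end

section \<open>Separating terms by rational valuations\<close>

primrec subterms :: "dmv_term \<Rightarrow> dmv_term set" where
  "subterms (Var i) = {Var i}"
| "subterms Zero = {Zero}"
| "subterms One = {One}"
| "subterms (Neg t) = insert (Neg t) (subterms t)"
| "subterms (Oplus s t) = insert (Oplus s t) (subterms s \<union> subterms t)"
| "subterms (Delta k t) = insert (Delta k t) (subterms t)"

lemma subterms_self [simp]: "t \<in> subterms t"
  by (cases t) auto

lemma finite_subterms [simp]: "finite (subterms t)"
  by (induction t) auto

lemma of_rat_min: "(of_rat (min a b) :: real) = min (of_rat a) (of_rat b)"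
  by (simp add: min_def of_rat_less_eq)

lemma finite_delta_indices_bounded:
  assumes "finite S"
  shows "\<exists>m. \<forall>k t. Delta k t \<in> S \<longrightarrow> Suc k \<le> m"
proof -
  have "finite ((\<lambda>u. case u of Delta k t \<Rightarrow> Suc k | _ \<Rightarrow> 0) ` S)" (is "finite (?g ` S)")
    using assms by simp
  then obtain m where "\<forall>n\<in>?g ` S. n \<le> m"
    unfolding finite_nat_set_iff_bounded_le by blast
  then show ?thesis
    by (intro exI[of _ m]) force
qed

context dmv_algebra
begin

lemma eval_closed: "(\<And>i. v i \<in> C) \<Longrightarrow> eval A v t \<in> C"
  by (induction t) (auto simp: delta_closed)

text \<open>
  The rational valuation is the composition of the valuation in \<open>A\<close> with the quotient map and the
  embedding of the finitely many subterm values. By induction it evaluates every subterm \<open>u\<close> to the image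
  of the value of \<open>u\<close> in \<open>A\<close>. For \<open>\<delta>\<^sub>n\<close> this holds because the multiple \<open>n.\<delta>\<^sub>n x = x\<close> does not overflow, so
  that the embedding sends \<open>\<delta>\<^sub>n x\<close> to the \<open>n\<close>-th part of the image of \<open>x\<close>.
\<close>

lemma rational_separation:
  assumes v: "\<And>i. v i \<in> C" and ne: "eval A v s \<noteq> eval A v t"
  shows "\<exists>w. (\<forall>i. w i \<in> carrier rat_unit_interval) \<and>
    eval rat_unit_interval w s \<noteq> eval rat_unit_interval w t"
proof -
  let ?a = "eval A v s" and ?b = "eval A v t" and ?R = rat_unit_interval
  have C: "eval A v u \<in> C" for u
    using v by (rule eval_closed)
  have "\<exists>P. prime_ideal P \<and> \<not> cong P ?a ?b"
  proof -
    have "?a \<ominus> ?b \<noteq> zero A \<or> ?b \<ominus> ?a \<noteq> zero A"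
      using ne C le_antisym by (metis diff_eq_zero)
    then show ?thesis
      using prime_ideal_avoiding[of "?a \<ominus> ?b"] prime_ideal_avoiding[of "?b \<ominus> ?a"] C
      by (auto simp: cong_def)
  qed
  then obtain P where prime: "prime_ideal P" and "\<not> cong P ?a ?b"
    by blast
  then have P: "ideal P"
    by (simp add: prime_ideal_def)
  let ?Q = "quotient P"
  define p where "p u = rep P (eval A v u)" for u
  have pne: "p s \<noteq> p t"
    using \<open>\<not> cong P ?a ?b\<close> C by (simp add: p_def rep_eq_iff[OF P])
  interpret Q: mv_chain ?Q
    using prime by (rule quotient_mv_chain)
  have pQ: "p u \<in> carrier ?Q" for u
    using C by (simp add: p_def quotient_def)
  have nontrivial: "zero ?Q \<noteq> one ?Q"
  proof
    assume "zero ?Q = one ?Q"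
    then have "p u = one ?Q" for u
      using pQ[of u] by (metis Q.oplus_one Q.oplus_zero)
    then show False
      using pne by simp
  qed
  define S where "S = subterms s \<union> subterms t"
  have "finite S"
    by (simp add: S_def)
  then obtain m where m: "\<And>k u. Delta k u \<in> S \<Longrightarrow> Suc k \<le> m"
    using finite_delta_indices_bounded by blast
  have "finite (p ` S)" "p ` S \<subseteq> carrier ?Q"
    using pQ \<open>finite S\<close> by auto
  from Q.rational_embedding[OF nontrivial this, of m] obtain f :: "'a \<Rightarrow> rat"
    where f_zero: "f (zero ?Q) = 0" and f_one: "f (one ?Q) = 1"
      and f_range: "\<forall>x\<in>p ` S. 0 \<le> f x \<and> f x \<le> 1" and f_inj: "inj_on f (p ` S)"
      and f_neg: "\<forall>x\<in>p ` S. neg ?Q x \<in> p ` S \<longrightarrow> f (neg ?Q x) = 1 - f x"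
      and f_oplus: "\<forall>x\<in>p ` S. \<forall>y\<in>p ` S. oplus ?Q x y \<in> p ` S \<longrightarrow> f (oplus ?Q x y) = min 1 (f x + f y)"
      and f_ndot: "\<forall>x\<in>p ` S. \<forall>n\<le>m. odot ?Q x (ndot ?Q (n - 1) x) = zero ?Q \<longrightarrow>
        ndot ?Q n x \<in> p ` S \<longrightarrow> f (ndot ?Q n x) = of_nat n * f x"
    by (elim exE conjE)
  \<comment> \<open>Variables outside \<open>s\<close> and \<open>t\<close> get the value \<open>0\<close>, so that the valuation stays in the unit interval.\<close>
  define w :: "nat \<Rightarrow> real" where "w i = (if Var i \<in> S then of_rat (f (p (Var i))) else 0)" for i
  have "w i \<in> carrier ?R" for i
    using f_range by (auto simp: w_def rat_unit_interval_def)
  moreover have eval_w: "eval ?R w u = of_rat (f (p u))" if "subterms u \<subseteq> S" for u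
    using that
  proof (induction u)
    case (Var i)
    then show ?case by (simp add: w_def)
  next
    case Zero
    then show ?case using f_zero by (simp add: rat_unit_interval_def p_def rep_hom[OF P])
  next
    case One
    then show ?case using f_one by (simp add: rat_unit_interval_def p_def rep_hom[OF P])
  next
    case (Neg u)
    then have "u \<in> S" "Neg u \<in> S"
      using subterms_self[of u] by auto
    moreover have "p (Neg u) = neg ?Q (p u)"
      using C by (simp add: p_def rep_hom[OF P])
    ultimately have "f (p (Neg u)) = 1 - f (p u)"
      using f_neg by force
    then show ?case
      using Neg by (simp add: rat_unit_interval_def of_rat_diff)
  next
    case (Oplus u u')
    then have S: "u \<in> S" "u' \<in> S" "Oplus u u' \<in> S"
      using subterms_self[of u] subterms_self[of u'] by auto
    have p: "p (Oplus u u') = oplus ?Q (p u) (p u')"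
      using C by (simp add: p_def rep_hom[OF P])
    then have "f (p (Oplus u u')) = min 1 (f (p u) + f (p u'))"
      using S f_oplus by (metis image_eqI)
    then show ?case
      using Oplus by (simp add: rat_unit_interval_def of_rat_min of_rat_add)
  next
    case (Delta k u)
    then have S: "u \<in> S" "Delta k u \<in> S"
      using subterms_self[of u] by auto
    let ?d = "eval A v (Delta k u)"
    have d: "ndot A (Suc k) ?d = eval A v u" "?d \<odot> ndot A k ?d = zero A"
      using D1[of "Suc k" "eval A v u"] D2[of "Suc k" "eval A v u"] C by (simp_all del: ndot.simps)
    have "ndot ?Q (Suc k) (p (Delta k u)) = p u"
      unfolding p_def by (simp only: rep_ndot[OF P] C d)
    moreover have "odot ?Q (p (Delta k u)) (ndot ?Q (Suc k - 1) (p (Delta k u))) = zero ?Q"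
      unfolding p_def by (simp only: diff_Suc_1 rep_ndot[OF P] rep_odot[OF P] rep_hom[OF P] C ndot_closed d)
    ultimately have "f (p u) = of_nat (Suc k) * f (p (Delta k u))"
      using S f_ndot m[OF S(2)] by (metis image_eqI)
    then have "(of_rat (f (p u)) :: real) = of_rat (of_nat (Suc k) * f (p (Delta k u)))"
      by simp
    also have "\<dots> = real (Suc k) * of_rat (f (p (Delta k u)))"
      by (simp only: of_rat_mult of_rat_of_nat_eq)
    finally show ?case
      using Delta by (simp add: rat_unit_interval_def field_simps)
  qed
  moreover have "f (p s) \<noteq> f (p t)"
    using f_inj pne by (auto simp: inj_on_def S_def)
  ultimately show ?thesis
    by (intro exI[of _ w]) (auto simp: S_def)
qed

end

section \<open>The variety of DMV-algebras\<close>

lemma eval_Odot: "eval A v (Odot s t) = odot A (eval A v s) (eval A v t)"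
  by (simp add: Odot_def odot_def)

lemma eval_Ndot: "eval A v (Ndot n t) = ndot A n (eval A v t)"
  by (induction n) auto

lemma dmv_algebra_in_variety:
  assumes "dmv_algebra A"
  shows "A \<in> variety dmv_identities"
proof -
  interpret dmv_algebra A by fact
  have "dmv_structure A"
    by (auto simp: dmv_structure_def delta_closed)
  moreover have "satisfies A e" if "e \<in> dmv_identities" for e
    unfolding satisfies_def
  proof (intro allI impI)
    fix v :: "nat \<Rightarrow> 'a" assume "\<forall>i. v i \<in> C"
    then have "v i \<in> C" for i by blast
    moreover have "ndot A (Suc k) (delta A (Suc k) (v 0)) = v 0"
      "odot A (delta A (Suc k) (v 0)) (ndot A k (delta A (Suc k) (v 0))) = zero A" for k
      using D1[of "Suc k" "v 0"] D2[of "Suc k" "v 0"] calculation by (simp_all del: ndot.simps)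
    ultimately show "eval A v (fst e) = eval A v (snd e)"
      using that by (auto simp: dmv_identities_def mv_identities_def Let_def eval_Odot eval_Ndot
          simp del: ndot.simps Ndot.simps) (rule oplus_assoc oplus_comm lukasiewicz; simp)+
  qed
  ultimately show ?thesis
    by (simp add: variety_def)
qed

lemma in_variety_dmv_algebra:
  assumes "A \<in> variety dmv_identities"
  shows "dmv_algebra A"
proof -
  have struct: "dmv_structure A"
    and sat: "\<And>s t v. (s, t) \<in> dmv_identities \<Longrightarrow> (\<And>i. v i \<in> carrier A) \<Longrightarrow> eval A v s = eval A v t"
    using assms by (auto simp: variety_def satisfies_def)
  have mv: "eval A v s = eval A v t" if "(s, t) \<in> mv_identities" "\<And>i. v i \<in> carrier A" for s t v
    using that by (intro sat) (auto simp: dmv_identities_def)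
  define val where "val x y z i = (if i = 0 then x else if i = 1 then y else z)" for x y z :: 'a and i :: nat
  have val [simp]: "val x y z 0 = x" "val x y z (Suc 0) = y" "val x y z 2 = z" for x y z
    by (auto simp: val_def)
  have val_closed: "val x y z i \<in> carrier A" if "x \<in> carrier A" "y \<in> carrier A" "z \<in> carrier A" for x y z i
    using that by (simp add: val_def)
  have zero: "zero A \<in> carrier A"
    using struct by (simp add: dmv_structure_def)
  show ?thesis
  proof
    fix x y z assume xyz: "x \<in> carrier A" "y \<in> carrier A" "z \<in> carrier A"
    then show "oplus A x (oplus A y z) = oplus A (oplus A x y) z"
      using mv[of "Oplus (Var 0) (Oplus (Var 1) (Var 2))" "Oplus (Oplus (Var 0) (Var 1)) (Var 2)" "val x y z"]
      by (simp add: mv_identities_def Let_def val_closed)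
  next
    fix x y assume xy: "x \<in> carrier A" "y \<in> carrier A"
    then show "oplus A x y \<in> carrier A"
      using struct by (simp add: dmv_structure_def)
    show "oplus A x y = oplus A y x"
      using xy mv[of "Oplus (Var 0) (Var 1)" "Oplus (Var 1) (Var 0)" "val x y x"]
      by (simp add: mv_identities_def Let_def val_closed)
    show "oplus A (neg A (oplus A (neg A x) y)) y = oplus A (neg A (oplus A (neg A y) x)) x"
      using xy mv[of "Oplus (Neg (Oplus (Neg (Var 0)) (Var 1))) (Var 1)"
        "Oplus (Neg (Oplus (Neg (Var 1)) (Var 0))) (Var 0)" "val x y x"]
      by (simp add: mv_identities_def Let_def val_closed)
  next
    fix x assume x: "x \<in> carrier A"
    then show "neg A x \<in> carrier A"
      using struct by (simp add: dmv_structure_def)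
    show "oplus A x (zero A) = x" "oplus A x (one A) = one A"
      using x mv[of "Oplus (Var 0) Zero" "Var 0" "val x x x"] mv[of "Oplus (Var 0) One" One "val x x x"]
      by (simp_all add: mv_identities_def Let_def val_closed)
  next
    show "zero A \<in> carrier A" "one A \<in> carrier A"
      using struct by (simp_all add: dmv_structure_def)
    show "neg A (zero A) = one A" "neg A (one A) = zero A"
      using mv[of "Neg Zero" One "\<lambda>_. zero A"] mv[of "Neg One" Zero "\<lambda>_. zero A"] zero
      by (simp_all add: mv_identities_def Let_def)
  next
    fix n :: nat and x assume n: "1 \<le> n" and x: "x \<in> carrier A"
    then show "delta A n x \<in> carrier A"
      using struct by (simp add: dmv_structure_def)
    obtain k where k: "n = Suc k"
      using n by (cases n) auto
    have "(Ndot (Suc k) (Delta k (Var 0)), Var 0) \<in> dmv_identities"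
      "(Odot (Delta k (Var 0)) (Ndot k (Delta k (Var 0))), Zero) \<in> dmv_identities"
      unfolding dmv_identities_def by blast+
    from this[THEN sat, of "\<lambda>_. x"] show "ndot A n (delta A n x) = x"
      "odot A (delta A n x) (ndot A (n - 1) (delta A n x)) = zero A"
      using x unfolding eval_Odot eval_Ndot by (simp_all add: k del: ndot.simps)
  qed
qed

lemma ndot_rat_unit_interval: "0 \<le> x \<Longrightarrow> ndot rat_unit_interval n x = min 1 (real n * x)"
  by (induction n) (auto simp: rat_unit_interval_def min_def algebra_simps)

lemma dmv_algebra_rat_unit_interval: "dmv_algebra rat_unit_interval"
proof
  fix n :: nat and x assume n: "1 \<le> n" and x: "x \<in> carrier rat_unit_interval"
  have x01: "0 \<le> x" "x \<le> 1" "x \<in> \<rat>"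
    using x by (auto simp: rat_unit_interval_def)
  have "x / real n \<le> x"
    using n x01 mult_left_mono[of 1 "real n" x] by (simp add: divide_le_eq)
  then show "delta rat_unit_interval n x \<in> carrier rat_unit_interval"
    using x01 by (auto simp: rat_unit_interval_def)
  have d: "delta rat_unit_interval n x = x / real n"
    by (simp add: rat_unit_interval_def)
  show "ndot rat_unit_interval n (delta rat_unit_interval n x) = x"
    using n x01 by (simp add: d ndot_rat_unit_interval)
  have "x / real n + real (n - 1) * (x / real n) = x"
    using n by (simp add: field_simps of_nat_diff)
  then have "x / real n + min 1 (real (n - 1) * (x / real n)) \<le> 1"
    using x01 by linarith
  then show "odot rat_unit_interval (delta rat_unit_interval n x)
      (ndot rat_unit_interval (n - 1) (delta rat_unit_interval n x)) = zero rat_unit_interval"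
    using x01 by (simp add: d ndot_rat_unit_interval odot_def) (simp add: rat_unit_interval_def)
qed (auto simp: rat_unit_interval_def min_def)

theorem theorem3p15:
  shows "{A :: 'a dmv. dmv_algebra A} = variety dmv_identities
    \<and> dmv_algebra rat_unit_interval
    \<and> (\<forall>E. rat_unit_interval \<in> variety E \<longrightarrow> {A :: 'a dmv. dmv_algebra A} \<subseteq> variety E)"
proof (intro conjI allI impI)
  show "{A :: 'a dmv. dmv_algebra A} = variety dmv_identities"
    using dmv_algebra_in_variety in_variety_dmv_algebra by blast
  show "dmv_algebra rat_unit_interval"
    by (rule dmv_algebra_rat_unit_interval)
  fix E assume R: "rat_unit_interval \<in> variety E"
  show "{A :: 'a dmv. dmv_algebra A} \<subseteq> variety E"
  proof
    fix A :: "'a dmv" assume "A \<in> {A. dmv_algebra A}"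
    then interpret dmv_algebra A by simp
    have "satisfies A e" if "e \<in> E" for e
      unfolding satisfies_def
    proof (intro allI impI, rule ccontr)
      fix v assume "\<forall>i. v i \<in> C" "eval A v (fst e) \<noteq> eval A v (snd e)"
      then obtain w where "\<forall>i. w i \<in> carrier rat_unit_interval"
        "eval rat_unit_interval w (fst e) \<noteq> eval rat_unit_interval w (snd e)"
        using rational_separation[of v "fst e" "snd e"] by blast
      then show False
        using R that unfolding variety_def satisfies_def by blast
    qed
    moreover have "dmv_structure A"
      by (auto simp: dmv_structure_def delta_closed)
    ultimately show "A \<in> variety E"
      by (simp add: variety_def)
  qed
qed

end
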